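(* For all integers $n\ge 0$ and $\alpha\ge 1$, every prime $p\ge 5$, and every $j\in\{1,2,\ldots,p-1\}$, $$d\left(6p^{2\alpha}n+\frac{(24j+9p)p^{2\alpha-1}-1}{4}\right)\equiv 0\pmod 9.$$
   Context: For a positive integer $k$, $(q^k;q^k)_\infty:=\prod_{m\ge 1}(1-q^{km})$, viewed as a formal power series in $q$ with integer coefficients. The integers $d(n)$ ($n\ge 0$) are defined by the generating function $$\sum_{n=0}^\infty d(n)q^n=\frac{(q^3;q^3)_\infty^3}{(q;q)_\infty(q^2;q^2)_\infty}.$$ *)

theory Defs
  imports
    "HOL-Analysis.Infinite_Products"
    "HOL-Computational_Algebra.Formal_Power_Series"
    "HOL-Number_Theory.Cong"
begin

(* The limit of the partial products is taken in the metric topology of the type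
   int fps, i.e. coefficientwise; the factors for m >= 1 are indexed by m + 1. *)
definition qpoch :: "nat \<Rightarrow> int fps" where
  "qpoch k = (\<Prod>m. 1 - fps_X ^ (k * (m + 1)))"

(* Division is not available on int fps because int is not a field.  The
   denominator has constant term 1, so its reciprocal with integer coefficients
   is the right inverse with constant term 1; see d_generating_function. *)
definition d :: "nat \<Rightarrow> int" where
  "d n = fps_nth (qpoch 3 ^ 3 * fps_right_inverse (qpoch 1 * qpoch 2) 1) n"

lemma qpoch_partial_nth:
  assumes "k \<ge> 1" "n \<le> N"
  shows "fps_nth (\<Prod>m<N. 1 - fps_X ^ (k * (m + 1)) :: int fps) n =
         fps_nth (\<Prod>m<n. 1 - fps_X ^ (k * (m + 1))) n"
  using assms(2)
proof (induction N rule: dec_induct)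
  case base
  show ?case by (rule refl)
next
  case (step N)
  have "N + 1 \<le> k * (N + 1)"
    using assms(1) by (metis mult_le_mono1 mult_1)
  then have lt: "n < k * (N + 1)"
    using step.hyps by linarith
  define P :: "int fps" where "P = (\<Prod>m<N. 1 - fps_X ^ (k * (m + 1)))"
  have "(\<Prod>m<Suc N. 1 - fps_X ^ (k * (m + 1))) = P - P * fps_X ^ (k * (N + 1))"
    unfolding prod.lessThan_Suc P_def[symmetric] by (simp only: right_diff_distrib mult_1_right)
  then show ?case
    using step.IH lt unfolding P_def[symmetric]
    by (simp only: fps_sub_nth fps_X_power_mult_right_nth if_True diff_zero)
qed

lemma
  assumes "k \<ge> 1"
  shows has_prod_qpoch: "(\<lambda>m. 1 - fps_X ^ (k * (m + 1)) :: int fps) has_prod qpoch k"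
    and qpoch_nth: "n \<le> N \<Longrightarrow>
      fps_nth (qpoch k) n = fps_nth (\<Prod>m<N. 1 - fps_X ^ (k * (m + 1))) n"
proof -
  define f where "f = (\<lambda>m. 1 - fps_X ^ (k * (m + 1)) :: int fps)"
  define P where "P = Abs_fps (\<lambda>n. fps_nth (\<Prod>m<n. f m) n)"
  have stable: "fps_nth (\<Prod>m<N. f m) n = fps_nth P n" if "n \<le> N" for n N
    using qpoch_partial_nth[OF assms that] unfolding f_def P_def by simp
  have "(\<lambda>N. \<Prod>m\<le>N. f m) \<longlonglongrightarrow> P"
  proof (rule tendsto_fpsI)
    fix n
    show "\<forall>\<^sub>F N in sequentially. fps_nth (\<Prod>m\<le>N. f m) n = fps_nth P n"
      using eventually_ge_at_top[of n]
      by eventually_elim (metis stable lessThan_Suc_atMost le_SucI)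
  qed
  moreover have "fps_nth P 0 = 1"
    by (simp add: P_def)
  then have "P \<noteq> 0"
    by auto
  ultimately have "f has_prod P"
    by (simp add: has_prod_def raw_has_prod_def)
  moreover from this have "qpoch k = P"
    unfolding qpoch_def f_def by (simp only: has_prod_unique[symmetric])
  ultimately show "(\<lambda>m. 1 - fps_X ^ (k * (m + 1)) :: int fps) has_prod qpoch k"
    and "n \<le> N \<Longrightarrow>
      fps_nth (qpoch k) n = fps_nth (\<Prod>m<N. 1 - fps_X ^ (k * (m + 1))) n"
    using stable unfolding f_def by simp_all
qed

lemma d_generating_function:
  "Abs_fps d * (qpoch 1 * qpoch 2) = qpoch 3 ^ 3"
proof -
  define D where "D = qpoch 1 * qpoch 2"
  have "fps_nth D 0 = 1"
    using qpoch_nth[of 1 0 0] qpoch_nth[of 2 0 0] by (simp add: D_def)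
  then have "D * fps_right_inverse D 1 = 1"
    by (intro fps_right_inverse) simp
  moreover have "Abs_fps d = qpoch 3 ^ 3 * fps_right_inverse D 1"
    by (simp add: fps_eq_iff d_def D_def)
  then have "Abs_fps d * D = qpoch 3 ^ 3 * (D * fps_right_inverse D 1)"
    by (simp only: mult.assoc mult.commute[of D])
  ultimately show ?thesis
    by (simp add: D_def)
qed

(* The quotient by 4 in the argument of d is exact. *)
lemma argument_exact:
  fixes p \<alpha> j :: nat
  assumes "odd p" "\<alpha> \<ge> 1"
  shows "4 dvd (24 * j + 9 * p) * p ^ (2 * \<alpha> - 1) - 1"
proof -
  have p_pow: "p ^ (2 * \<alpha>) = p * p ^ (2 * \<alpha> - 1)"
    using assms(2) by (subst power_Suc[symmetric]) simp
  have "p mod 4 = 1 \<or> p mod 4 = 3"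
    using assms(1) by presburger
  then have "p ^ 2 mod 4 = 1"
    using power_mod[of p 4 2] by auto
  then have "[p ^ (2 * \<alpha>) = 1] (mod 4)"
    using cong_pow[of "p ^ 2" 1 4 \<alpha>] by (simp add: cong_def power_mult)
  then have "[24 * (j * p ^ (2 * \<alpha> - 1)) + 9 * p ^ (2 * \<alpha>) = 0 + 9 * 1] (mod 4)"
    by (intro cong_add cong_mult) (simp_all add: cong_def)
  moreover have "(24 * j + 9 * p) * p ^ (2 * \<alpha> - 1) =
      24 * (j * p ^ (2 * \<alpha> - 1)) + 9 * p ^ (2 * \<alpha>)"
    by (simp only: p_pow add_mult_distrib mult.assoc)
  ultimately have "((24 * j + 9 * p) * p ^ (2 * \<alpha> - 1)) mod 4 = 1"
    by (simp add: cong_def)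
  then show ?thesis
    using dvd_minus_mod[of 4 "(24 * j + 9 * p) * p ^ (2 * \<alpha> - 1)"] by simp
qed

end

theory Submission
  imports Defs "HOL-Computational_Algebra.Polynomial"
begin

text \<open>
  Write \<open>f_k\<close> for \<open>qpoch k\<close>.  Since \<open>f_1^9 \<equiv> f_3^3\<close> modulo 9, the generating function of \<open>d\<close> is congruent
  to \<open>f_1^8 / f_2 = (f_1^3)^2 \<cdot> (f_1^2 / f_2)\<close>.  Both factors are classical theta series: Jacobi's
  \<open>2 f_1^3 = \<Sum> (-1)^k (2k+1) q^(k(k+1)/2)\<close> and Gauss's \<open>f_1^2 / f_2 = \<Sum> (-1)^a q^(a^2)\<close>, summed over all
  integers (\<open>jacobi_cube_eq\<close>, \<open>gauss_square_eq\<close>).  Hence \<open>4 d(N)\<close> is modulo 9 a sum over the solutions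
  of \<open>a^2 + k(k+1)/2 + l(l+1)/2 = N\<close>, weighted by \<open>(-1)^(a+k+l) (2k+1)(2l+1)\<close>.

  Put \<open>m = 4N + 1\<close> and let \<open>N\<close> be even.  The rotation \<open>k = b + c\<close>, \<open>l = b - c\<close>, the symmetry between \<open>a\<close>
  and \<open>c\<close>, and a second rotation \<open>a = u + w\<close>, \<open>c = u - w\<close> turn that sum into
  \<open>\<Sum> (-1)^(u+w) (3 y^2 - m)\<close> over the solutions of \<open>8 u^2 + 8 w^2 + y^2 = m\<close> with \<open>y\<close> odd
  (\<open>d_mod_9_ternary\<close>).

  The plain signed count \<open>\<Sum> (-1)^(u+w)\<close> over these solutions vanishes unless \<open>m\<close> is a square: its
  generating function is \<open>(f_1^2/f_2)^2 \<cdot> (2 f_2^2/f_1) = 2 f_1^3\<close>, and Jacobi's series lives on the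
  triangular numbers (\<open>sum_ternary_eq_0\<close>).  So for nonsquare \<open>m\<close> only \<open>3 \<Sum> (-1)^(u+w) y^2\<close> remains, and
  only its value modulo 9 matters, so \<open>y^2\<close> may be replaced by 1 if 3 does not divide \<open>y\<close>, and by 0
  otherwise.  If moreover 3 divides \<open>m\<close>, then \<open>3 | y\<close> forces \<open>3 | u\<close> and \<open>3 | w\<close>, so both resulting
  sums are signed counts, for \<open>m\<close> and for \<open>m/9\<close>, and both vanish (\<open>weighted_sum_ternary\<close>).  Altogether
  9 divides \<open>d(N)\<close> whenever \<open>N\<close> is even and \<open>4N + 1\<close> is a nonsquare multiple of 3 (\<open>nine_dvd_d\<close>).

  In the theorem, \<open>4N + 1 = 3 p^(2\<alpha>-1) (8pn + 8j + 3p)\<close>, in which the prime \<open>p\<close> occurs with odd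
  exponent \<open>2\<alpha> - 1\<close>; so \<open>4N + 1\<close> is not a square.

  The three theta identities come from the finite \<open>q\<close>-binomial theorem: a centred specialisation gives
  a finite theta sum with Gaussian binomials as coefficients, and these tend to \<open>1 / f_k\<close> coefficientwise.
\<close>


section \<open>Congruences in commutative rings and power series\<close>

text \<open>
  Congruence is written as \<open>m dvd a - b\<close>, which makes sense in every commutative ring.  Two moduli are
  used: integers such as 9, and powers of \<open>fps_X\<close>, for which congruence means agreement of the low
  coefficients.
\<close>
lemma dvd_diff_mult:
  fixes m :: "'a::comm_ring_1"
  assumes "m dvd a - b" "m dvd c - e"
  shows "m dvd a * c - b * e"
proof -
  have "a * c - b * e = (a - b) * c + b * (c - e)"
    by (simp add: algebra_simps)
  then show ?thesis using assms by (metis dvd_add dvd_mult dvd_mult2)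
qed

lemma dvd_diff_power:
  fixes m :: "'a::comm_ring_1"
  assumes "m dvd a - b"
  shows "m dvd a ^ k - b ^ k"
  by (induction k) (simp_all add: dvd_diff_mult assms)

lemma dvd_diff_prod:
  fixes m :: "'a::comm_ring_1"
  assumes "\<And>i. i \<in> I \<Longrightarrow> m dvd f i - g i"
  shows "m dvd prod f I - prod g I"
  using assms by (induction I rule: infinite_finite_induct) (simp_all add: dvd_diff_mult)

lemma dvd_diff_trans:
  fixes m :: "'a::comm_ring_1"
  assumes "m dvd a - b" "m dvd b - c"
  shows "m dvd a - c"
  using dvd_add[OF assms] by simp

lemma dvd_diff_sym:
  fixes m :: "'a::comm_ring_1"
  assumes "m dvd a - b"
  shows "m dvd b - a"
  using assms by (subst dvd_minus_iff[symmetric]) simp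

lemma nine_dvd_cube_diff:
  fixes a b :: "'a::comm_ring_1"
  assumes "3 dvd a - b"
  shows "9 dvd a ^ 3 - b ^ 3"
proof -
  obtain t where "a - b = 3 * t" using assms by (rule dvdE)
  then have "a = b + 3 * t" by (simp add: algebra_simps)
  then have "a ^ 3 - b ^ 3 = 9 * (b ^ 2 * t + 3 * b * t ^ 2 + 3 * t ^ 3)"
    by (simp add: power3_eq_cube power2_eq_square algebra_simps)
  then show ?thesis by (rule dvdI)
qed

lemma fps_X_power_dvd_iff:
  fixes f :: "'a::comm_ring_1 fps"
  shows "fps_X ^ n dvd f \<longleftrightarrow> (\<forall>i<n. fps_nth f i = 0)"
proof
  assume "fps_X ^ n dvd f"
  then show "\<forall>i<n. fps_nth f i = 0"
    by (auto elim!: dvdE simp: fps_X_power_mult_nth)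
next
  assume *: "\<forall>i<n. fps_nth f i = 0"
  have "f = fps_X ^ n * fps_shift n f"
    using * by (intro fps_ext) (simp add: fps_X_power_mult_nth)
  then show "fps_X ^ n dvd f" by (rule dvdI)
qed

lemma fps_eqI_mod_X_power:
  fixes f g :: "'a::comm_ring_1 fps"
  assumes "\<And>n. fps_X ^ n dvd f - g"
  shows "f = g"
proof (rule fps_ext)
  fix n
  show "fps_nth f n = fps_nth g n"
    using assms[of "Suc n"] by (simp add: fps_X_power_dvd_iff del: power_Suc)
qed

section \<open>The q-binomial theorem\<close>

definition qfac :: "'a::comm_ring_1 \<Rightarrow> nat \<Rightarrow> 'a" where
  "qfac q n = (\<Prod>i<n. 1 - q ^ Suc i)"

lemma qfac_0 [simp]: "qfac q 0 = 1"
  and qfac_Suc: "qfac q (Suc n) = qfac q n * (1 - q ^ Suc n)"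
  by (simp_all add: qfac_def)

lemma qpoch_mod_X_power:
  assumes "k \<ge> 1" "n \<le> Suc N"
  shows "fps_X ^ n dvd qpoch k - qfac (fps_X ^ k) N"
proof -
  have "fps_nth (qpoch k) i = fps_nth (qfac (fps_X ^ k) N) i" if "i < n" for i
    using qpoch_nth[OF assms(1), of i N] that assms(2)
    by (simp only: qfac_def power_mult Suc_eq_plus1)
  then show ?thesis by (simp add: fps_X_power_dvd_iff)
qed

lemma qpoch_inverse:
  assumes "k \<ge> 1"
  obtains G where "G * qpoch k = 1"
proof -
  have "fps_nth (qpoch k) 0 = 1"
    using qpoch_nth[OF assms, of 0 0] by simp
  then have "qpoch k * fps_right_inverse (qpoch k) 1 = 1"
    by (intro fps_right_inverse) simp
  then show ?thesis using that by (metis mult.commute)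
qed

text \<open>
  With constant term 1, \<open>qpoch k\<close> is a unit and can be cancelled in every congruence.
\<close>
lemma dvd_qpoch_mult_iff:
  assumes "k \<ge> 1"
  shows "m dvd qpoch k * f \<longleftrightarrow> m dvd f"
proof
  assume *: "m dvd qpoch k * f"
  obtain G where "G * qpoch k = 1" using qpoch_inverse[OF assms] .
  then have "f = G * (qpoch k * f)" by (simp flip: mult.assoc)
  then show "m dvd f" using * by (metis dvd_mult)
qed simp

text \<open>
  The Gaussian binomial coefficient, by \<open>q\<close>-Pascal recursion; a quotient of \<open>q\<close>-factorials need not
  exist in a commutative ring.
\<close>
fun gauss_binomial :: "'a::comm_ring_1 \<Rightarrow> nat \<Rightarrow> nat \<Rightarrow> 'a" where
  "gauss_binomial q n 0 = 1"
| "gauss_binomial q 0 (Suc k) = 0"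
| "gauss_binomial q (Suc n) (Suc k) = gauss_binomial q n k + q ^ Suc k * gauss_binomial q n (Suc k)"

lemma gauss_binomial_eq_0: "n < k \<Longrightarrow> gauss_binomial q n k = 0"
  by (induction q n k rule: gauss_binomial.induct) auto

lemma gauss_binomial_self [simp]: "gauss_binomial q n n = 1"
  by (induction n) (simp_all add: gauss_binomial_eq_0)

text \<open>
  The quotient formula for Gaussian binomials with denominators cleared.
\<close>
lemma qfac_mult_gauss_binomial: "qfac q k * qfac q l * gauss_binomial q (k + l) k = qfac q (k + l)"
proof (induction "k + l" arbitrary: k l)
  case (Suc N)
  show ?case
  proof (cases k)
    case (Suc k')
    show ?thesis
    proof (cases l)
      case (Suc l')
      have 1: "qfac q k' * qfac q l * gauss_binomial q (k' + l) k' = qfac q (k' + l)"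
        using Suc.hyps(1)[of k' l] Suc.hyps(2) \<open>k = Suc k'\<close> by simp
      have 2: "qfac q k * qfac q l' * gauss_binomial q (k + l') k = qfac q (k + l')"
        using Suc.hyps(1)[of k l'] Suc.hyps(2) Suc by simp
      have N: "k + l' = N" "k' + l = N" using Suc.hyps(2) \<open>k = Suc k'\<close> Suc by auto
      have "qfac q k * qfac q l * gauss_binomial q (k + l) k
          = (1 - q ^ k) * (qfac q k' * qfac q l * gauss_binomial q N k')
            + q ^ k * (1 - q ^ l) * (qfac q k * qfac q l' * gauss_binomial q N k)"
        unfolding Suc.hyps(2)[symmetric]
        by (simp add: qfac_Suc \<open>k = Suc k'\<close> Suc algebra_simps)
      also have "\<dots> = (1 - q ^ k) * qfac q N + q ^ k * (1 - q ^ l) * qfac q N"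
        using 1 2 unfolding N by simp
      also have "\<dots> = qfac q N * (1 - q ^ (k + l))"
        by (simp add: algebra_simps power_add)
      finally show ?thesis by (simp add: Suc.hyps(2)[symmetric] qfac_Suc)
    qed simp
  qed simp
qed simp

text \<open>
  Modulo a power of \<open>fps_X\<close> up to \<open>min s t + 1\<close>, the three \<open>q\<close>-factorials in the quotient formula all
  agree with \<open>qpoch a\<close>, so that two of the three cancel.
\<close>
lemma gauss_binomial_mod_X_power:
  assumes "a \<ge> 1"
  shows "fps_X ^ Suc (min s t) dvd qpoch a * gauss_binomial (fps_X ^ a) (s + t) s - 1"
proof -
  define m F g where "m = (fps_X :: int fps) ^ Suc (min s t)" and "F = qpoch a"
    and "g = gauss_binomial (fps_X ^ a :: int fps) (s + t) s"
  have *: "m dvd F - qfac (fps_X ^ a) r" if "r \<ge> min s t" for r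
    unfolding m_def F_def using assms that by (intro qpoch_mod_X_power) auto
  have "m dvd F * F * g - qfac (fps_X ^ a) s * qfac (fps_X ^ a) t * g"
    by (intro dvd_diff_mult *) auto
  then have "m dvd F * F * g - qfac (fps_X ^ a) (s + t)"
    unfolding g_def qfac_mult_gauss_binomial .
  moreover have "m dvd F - qfac (fps_X ^ a) (s + t)"
    by (rule *) auto
  ultimately have "m dvd (F * F * g - qfac (fps_X ^ a) (s + t)) - (F - qfac (fps_X ^ a) (s + t))"
    by (rule dvd_diff)
  then have "m dvd F * (F * g - 1)"
    by (simp add: algebra_simps)
  then show ?thesis
    unfolding F_def m_def g_def dvd_qpoch_mult_iff[OF assms] .
qed

lemma choose_two_0 [simp]: "0 choose 2 = 0"
  by (simp add: numeral_2_eq_2)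

lemma choose_two_Suc: "Suc k choose 2 = (k choose 2) + k"
  by (simp add: numeral_2_eq_2)

text \<open>
  The homogeneous form in \<open>x\<close> and \<open>y\<close> permits the centred choices \<open>y = q^n\<close>, \<open>x = \<plusminus>1\<close> without negative
  powers of \<open>q\<close>.  The induction splits off the factor with \<open>i = 0\<close> and replaces \<open>x\<close> by \<open>x q\<close>, which
  matches the recursion of \<open>gauss_binomial\<close>.
\<close>
lemma q_binomial:
  fixes x y q :: "'a::comm_ring_1"
  shows "(\<Prod>i<N. y + x * q ^ i)
    = (\<Sum>k\<le>N. q ^ (k choose 2) * gauss_binomial q N k * x ^ k * y ^ (N - k))"
proof (induction N arbitrary: x)
  case (Suc N)
  define c where "c k = q ^ (k choose 2) * gauss_binomial q N k * (x * q) ^ k" for k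
  have c0: "c 0 = 1" by (simp add: c_def)
  have cN: "c (Suc N) = 0" by (simp add: c_def gauss_binomial_eq_0)
  have rec: "q ^ (Suc k choose 2) * gauss_binomial q (Suc N) (Suc k) * x ^ Suc k = x * c k + c (Suc k)" for k
    by (simp add: c_def choose_two_Suc power_add power_mult_distrib algebra_simps)
  have "(\<Prod>i<Suc N. y + x * q ^ i) = (y + x) * (\<Prod>i<N. y + (x * q) * q ^ i)"
    by (subst prod.lessThan_Suc_shift) (simp add: mult.assoc)
  also have "\<dots> = (y + x) * (\<Sum>k\<le>N. c k * y ^ (N - k))"
    unfolding Suc.IH c_def ..
  also have "\<dots> = (\<Sum>k\<le>N. x * c k * y ^ (N - k)) + (\<Sum>k\<le>N. c k * y ^ (Suc N - k))"
    by (simp add: distrib_right sum_distrib_left Suc_diff_le algebra_simps sum.distrib)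
  also have "(\<Sum>k\<le>N. c k * y ^ (Suc N - k)) = (\<Sum>k\<le>Suc N. c k * y ^ (Suc N - k))"
    by (simp add: cN)
  also have "\<dots> = y ^ Suc N + (\<Sum>k\<le>N. c (Suc k) * y ^ (N - k))"
    by (subst sum.atMost_Suc_shift) (simp add: c0)
  finally have "(\<Prod>i<Suc N. y + x * q ^ i)
      = y ^ Suc N + (\<Sum>k\<le>N. (x * c k + c (Suc k)) * y ^ (N - k))"
    by (simp add: sum.distrib algebra_simps)
  then show ?case
    unfolding rec[symmetric] by (subst sum.atMost_Suc_shift) simp
qed simp

lemma gauss_binomial_pCons: "gauss_binomial [:q:] n k = [:gauss_binomial q n k:]"
  by (induction q n k rule: gauss_binomial.induct)
    (simp_all add: one_pCons poly_const_pow del: power_Suc)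

text \<open>
  Differentiation of the \<open>q\<close>-binomial theorem with respect to \<open>y\<close>, at a zero of the factor with index
  \<open>m\<close>: only the summand that removes this factor survives.  To differentiate, the theorem is applied
  in the polynomial ring, with \<open>y\<close> as the indeterminate.
\<close>
lemma q_binomial_deriv:
  fixes x y q :: "'a::idom"
  assumes "m < N" and "y + x * q ^ m = 0"
  shows "(\<Sum>k\<le>N. of_nat (N - k) * (q ^ (k choose 2) * gauss_binomial q N k * x ^ k * y ^ (N - k)))
    = y * (\<Prod>i\<in>{..<N} - {m}. y + x * q ^ i)"
proof -
  define R where "R = (\<Prod>i\<in>{..<N} - {m}. [:x * q ^ i, 1:])"
  define c where "c k = q ^ (k choose 2) * gauss_binomial q N k * x ^ k" for k
  have "(\<Prod>i<N. [:x * q ^ i, 1:]) = (\<Prod>i<N. [:0, 1:] + [:x:] * [:q:] ^ i)"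
    by (simp add: poly_const_pow mult.commute)
  also have "\<dots> = (\<Sum>k\<le>N. monom (c k) (N - k))"
    unfolding q_binomial
    by (simp add: gauss_binomial_pCons poly_const_pow c_def monom_altdef mult_ac)
  finally have eq: "[:x * q ^ m, 1:] * R = (\<Sum>k\<le>N. monom (c k) (N - k))"
    unfolding R_def using assms(1) by (subst prod.remove[of _ m, symmetric]) auto
  have "y * poly (pderiv (\<Sum>k\<le>N. monom (c k) (N - k))) y
      = (\<Sum>k\<le>N. of_nat (N - k) * (c k * y ^ (N - k)))"
    unfolding higher_pderiv_sum[of 1, simplified] poly_sum sum_distrib_left
  proof (intro sum.cong refl)
    fix k
    show "y * poly (pderiv (monom (c k) (N - k))) y = of_nat (N - k) * (c k * y ^ (N - k))"
      by (cases "N - k") (simp_all add: pderiv_monom poly_monom)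
  qed
  moreover have "poly (pderiv ([:x * q ^ m, 1:] * R)) y = poly R y"
    using assms(2) unfolding pderiv_mult poly_add poly_mult
    by (simp add: pderiv_pCons add.commute mult.commute)
  moreover have "poly R y = (\<Prod>i\<in>{..<N} - {m}. y + x * q ^ i)"
    by (simp add: R_def poly_prod add.commute)
  ultimately show ?thesis
    unfolding eq c_def by metis
qed

section \<open>Finite theta identities\<close>

definition parity_sign :: "int \<Rightarrow> int" where
  "parity_sign k = (if even k then 1 else - 1)"

lemma parity_sign_add: "parity_sign (k + l) = parity_sign k * parity_sign l"
  and parity_sign_diff: "parity_sign (k - l) = parity_sign k * parity_sign l"
  and parity_sign_of_nat: "parity_sign (int n) = (- 1) ^ n"
  by (auto simp: parity_sign_def uminus_power_if)

text \<open>
  The argument ranges over all integers, so that every triangular number is taken twice, at \<open>k\<close> and at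
  \<open>- 1 - k\<close>.  This makes the theta series below bilateral sums.
\<close>
definition tri :: "int \<Rightarrow> nat" where
  "tri k = nat (k * (k + 1) div 2)"

text \<open>
  Completing the square turns equations between triangular numbers into equations between odd
  squares.
\<close>
lemma tri_eq_iff: "tri k = n \<longleftrightarrow> (2 * k + 1)\<^sup>2 = 8 * int n + 1"
proof -
  have "even (k * (k + 1))" by simp
  then obtain t where t: "k * (k + 1) = 2 * t" by (rule dvdE)
  have "0 \<le> k * (k + 1)"
    by (cases "k \<ge> 0") (simp_all add: mult_nonpos_nonpos)
  then have "0 \<le> t" using t by simp
  have "(2 * k + 1)\<^sup>2 = 4 * (k * (k + 1)) + 1"
    by (simp add: power2_eq_square algebra_simps)
  then show ?thesis
    unfolding tri_def t using \<open>0 \<le> t\<close> by auto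
qed

lemma int_tri: "8 * int (tri k) = (2 * k + 1)\<^sup>2 - 1"
  using tri_eq_iff[of k "tri k"] by simp

lemma tri_growth: "\<bar>k\<bar> \<le> int (tri k) + 1"
proof -
  have "8 * \<bar>k\<bar> \<le> 4 * \<bar>k\<bar>\<^sup>2 - 4 * \<bar>k\<bar> + 8"
  proof (cases "\<bar>k\<bar> \<le> 1")
    case False
    then have "0 \<le> (\<bar>k\<bar> - 1) * (\<bar>k\<bar> - 2)" by simp
    then show ?thesis by (simp add: power2_eq_square algebra_simps)
  next
    case True
    then have "k \<in> {- 1, 0, 1}" by auto
    then show ?thesis by auto
  qed
  also have "\<dots> \<le> 8 * int (tri k) + 8"
    unfolding int_tri by (auto simp: abs_if power2_eq_square algebra_simps)
  finally show ?thesis by simp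
qed

lemma square_growth: "\<bar>k\<bar> \<le> int (nat (k\<^sup>2)) + 1"
proof -
  have "\<bar>k\<bar> * 1 \<le> \<bar>k\<bar> * \<bar>k\<bar>" if "k \<noteq> 0"
    using that by (intro mult_left_mono) auto
  then show ?thesis by (cases "k = 0") (auto simp: power2_eq_square)
qed

lemma prod_lessThan_add_reversed:
  fixes f :: "nat \<Rightarrow> 'a::comm_monoid_mult"
  shows "prod f {..<m + n} = (\<Prod>i<m. f (m - Suc i)) * (\<Prod>i<n. f (m + i))"
proof -
  have "prod f {..<m + n} = prod f {..<m} * (\<Prod>i<n. f (m + i))"
    by (induction n) (simp_all add: mult.assoc)
  then show ?thesis by (simp add: prod.nat_diff_reindex)
qed

lemma sum_lessThan_choose: "(\<Sum>i<n. i) = n choose 2"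
  by (induction n) (simp_all add: choose_two_Suc)

lemma choose_two_int: "2 * int (n choose 2) = int n * (int n - 1)"
  by (induction n) (simp_all add: choose_two_Suc algebra_simps)

text \<open>
  Centring the \<open>q\<close>-binomial theorem: for \<open>y = q^n\<close>, the exponent of \<open>q\<close> in the \<open>k\<close>-th term is a
  triangular number plus an amount that does not depend on \<open>k\<close> and cancels.
\<close>
lemma tri_exponent:
  assumes "k \<le> 2 * n + 1"
  shows "(k choose 2) + n * (2 * n + 1 - k)
    = (n choose 2) + n + n * n + tri (int k - int (n + 1))"
proof -
  define l where "l = 2 * n + 1 - k"
  have l: "int l = 2 * int n + 1 - int k" using assms by (simp add: l_def)
  have "8 * int ((k choose 2) + n * l)
      = 8 * int ((n choose 2) + n + n * n + tri (int k - int (n + 1)))"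
    using choose_two_int[of k] choose_two_int[of n] int_tri[of "int k - int (n + 1)"]
    by (simp add: l power2_eq_square algebra_simps)
  then show ?thesis unfolding l_def
    by (metis (no_types) mult_cancel_left of_nat_eq_iff zero_neq_numeral)
qed

text \<open>
  Below the centre \<open>i = n\<close> the common factor of \<open>q^n\<close> and \<open>x q^i\<close> is \<open>q^i\<close>, above it \<open>q^n\<close>; these
  powers, with \<open>q^n\<close> for the centre itself, add up to the amount in \<open>tri_exponent\<close>.
\<close>
lemma prod_off_centre:
  fixes q x :: "'a::idom"
  shows "q ^ n * (\<Prod>i\<in>{..<2 * n + 1} - {n}. q ^ n + x * q ^ i)
    = q ^ ((n choose 2) + n + n * n) *
      (\<Prod>i<n. (q ^ Suc i + x) * (1 + x * q ^ Suc i))"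
proof -
  have set: "{..<2 * n + 1} - {n} = {..<n} \<union> {Suc n..<Suc n + n}" by auto
  have "(\<Prod>i\<in>{..<2 * n + 1} - {n}. q ^ n + x * q ^ i)
      = (\<Prod>i<n. q ^ n + x * q ^ i) * (\<Prod>i<n. q ^ n + x * q ^ (Suc n + i))"
    unfolding set
  proof (subst prod.union_disjoint)
    have "prod f {Suc n..<Suc n + n} = (\<Prod>i<n. f (Suc n + i))" for f :: "nat \<Rightarrow> 'a"
      by (rule prod.reindex_bij_witness[of _ "\<lambda>i. Suc n + i" "\<lambda>i. i - Suc n"]) auto
    then show "(\<Prod>i<n. q ^ n + x * q ^ i) * (\<Prod>i = Suc n..<Suc n + n. q ^ n + x * q ^ i)
        = (\<Prod>i<n. q ^ n + x * q ^ i) * (\<Prod>i<n. q ^ n + x * q ^ (Suc n + i))"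
      by (simp only:)
  qed auto
  also have "(\<Prod>i<n. q ^ n + x * q ^ i) = (\<Prod>i<n. q ^ n + x * q ^ (n - Suc i))"
    by (rule prod.nat_diff_reindex[symmetric])
  also have "\<dots> = (\<Prod>i<n. q ^ (n - Suc i) * (q ^ Suc i + x))"
  proof (intro prod.cong refl)
    fix i assume "i \<in> {..<n}"
    then have "q ^ n = q ^ (n - Suc i) * q ^ Suc i"
      by (simp flip: power_add del: power_Suc)
    then show "q ^ n + x * q ^ (n - Suc i) = q ^ (n - Suc i) * (q ^ Suc i + x)"
      by (simp only: distrib_left distrib_right mult_ac)
  qed
  also have "\<dots> = q ^ (n choose 2) * (\<Prod>i<n. q ^ Suc i + x)"
    using sum.nat_diff_reindex[of "\<lambda>i. i" n]
    by (simp add: prod.distrib power_sum[symmetric] sum_lessThan_choose del: power_Suc)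
  also have "(\<Prod>i<n. q ^ n + x * q ^ (Suc n + i)) = (\<Prod>i<n. q ^ n * (1 + x * q ^ Suc i))"
    by (intro prod.cong refl) (simp add: power_add algebra_simps)
  also have "\<dots> = q ^ (n * n) * (\<Prod>i<n. 1 + x * q ^ Suc i)"
    by (simp add: prod.distrib power_mult del: power_Suc)
  finally show ?thesis
    by (simp add: prod.distrib power_add mult_ac del: power_Suc)
qed

text \<open>
  The case \<open>x = 1\<close>, \<open>y = q^n\<close> of the \<open>q\<close>-binomial theorem; the central factor is \<open>2 q^n\<close>.
\<close>
lemma finite_triangular:
  fixes q :: "'a::idom"
  assumes "q \<noteq> 0"
  shows "(\<Sum>k\<le>2 * n + 1. q ^ tri (int k - int (n + 1)) * gauss_binomial q (2 * n + 1) k)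
    = 2 * (\<Prod>i<n. 1 + q ^ Suc i)\<^sup>2"
proof -
  define e where "e = (n choose 2) + n + n * n"
  have "q ^ e * (\<Sum>k\<le>2 * n + 1. q ^ tri (int k - int (n + 1)) * gauss_binomial q (2 * n + 1) k)
      = (\<Sum>k\<le>2 * n + 1. q ^ (k choose 2) * gauss_binomial q (2 * n + 1) k * 1 ^ k * (q ^ n) ^ (2 * n + 1 - k))"
    unfolding sum_distrib_left
  proof (intro sum.cong refl)
    fix k assume k: "k \<in> {..2 * n + 1}"
    have "q ^ e * q ^ tri (int k - int (n + 1)) = q ^ (k choose 2) * (q ^ n) ^ (2 * n + 1 - k)"
      using tri_exponent[of k n] k unfolding e_def power_add[symmetric] power_mult[symmetric]
      by (simp only: atMost_iff)
    then show "q ^ e * (q ^ tri (int k - int (n + 1)) * gauss_binomial q (2 * n + 1) k)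
        = q ^ (k choose 2) * gauss_binomial q (2 * n + 1) k * 1 ^ k * (q ^ n) ^ (2 * n + 1 - k)"
      by (simp add: mult_ac)
  qed
  also have "\<dots> = (\<Prod>i<2 * n + 1. q ^ n + 1 * q ^ i)"
    by (rule q_binomial[symmetric])
  also have "\<dots> = 2 * (q ^ n * (\<Prod>i\<in>{..<2 * n + 1} - {n}. q ^ n + 1 * q ^ i))"
    by (subst prod.remove[of _ n]) (auto simp: mult_ac)
  also have "\<dots> = q ^ e * (2 * (\<Prod>i<n. 1 + q ^ Suc i)\<^sup>2)"
    unfolding prod_off_centre e_def
    by (simp add: prod.distrib power2_eq_square add.commute mult_ac)
  finally show ?thesis using assms by simp
qed

text \<open>
  For \<open>x = -1\<close>, \<open>y = q^n\<close> the central factor vanishes, so the \<open>q\<close>-binomial theorem itself gives 0 and its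
  derivative gives the product without that factor.  The derivative carries the weights
  \<open>2n + 1 - k\<close>; twice the derivative minus \<open>2n + 1\<close> times the vanishing sum has the weights
  \<open>2n + 1 - 2k\<close>, which change sign under reflection about the centre.
\<close>
lemma finite_jacobi:
  fixes q :: "'a::idom"
  assumes "q \<noteq> 0"
  shows "(\<Sum>k\<le>2 * n + 1. of_int (parity_sign (int k - int (n + 1)) * (2 * (int k - int (n + 1)) + 1))
      * q ^ tri (int k - int (n + 1)) * gauss_binomial q (2 * n + 1) k)
    = 2 * (qfac q n)\<^sup>2"
proof -
  define e where "e = (n choose 2) + n + n * n"
  define t where "t k = q ^ (k choose 2) * gauss_binomial q (2 * n + 1) k * (- 1) ^ k * (q ^ n) ^ (2 * n + 1 - k)"
    for k
  have sum0: "(\<Sum>k\<le>2 * n + 1. t k) = 0"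
    unfolding t_def q_binomial[symmetric] by (intro prod_zero) auto
  have "(- 1) ^ n * q ^ e * (\<Sum>k\<le>2 * n + 1. of_int (parity_sign (int k - int (n + 1)) * (2 * (int k - int (n + 1)) + 1))
      * q ^ tri (int k - int (n + 1)) * gauss_binomial q (2 * n + 1) k)
      = (\<Sum>k\<le>2 * n + 1. 2 * (of_nat (2 * n + 1 - k) * t k) - of_nat (2 * n + 1) * t k)"
    unfolding sum_distrib_left
  proof (intro sum.cong refl)
    fix k assume k: "k \<in> {..2 * n + 1}"
    have *: "q ^ e * q ^ tri (int k - int (n + 1)) = q ^ (k choose 2) * (q ^ n) ^ (2 * n + 1 - k)"
      using tri_exponent[of k n] k unfolding e_def power_add[symmetric] power_mult[symmetric]
      by (simp only: atMost_iff)
    have "parity_sign (int k - int (n + 1)) = - ((- 1) ^ n * (- 1) ^ k)"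
      by (simp add: parity_sign_diff parity_sign_add parity_sign_of_nat del: of_nat_Suc of_nat_add)
    then have "(- 1) ^ n * of_int (parity_sign (int k - int (n + 1)) * (2 * (int k - int (n + 1)) + 1))
        = (2 * of_nat (2 * n + 1 - k) - of_nat (2 * n + 1)) * ((- 1) ^ k :: 'a)"
      using k by (simp add: of_nat_diff algebra_simps uminus_power_if)
    then have "(- 1) ^ n * of_int (parity_sign (int k - int (n + 1)) * (2 * (int k - int (n + 1)) + 1))
          * (q ^ e * q ^ tri (int k - int (n + 1))) * gauss_binomial q (2 * n + 1) k
        = (2 * of_nat (2 * n + 1 - k) - of_nat (2 * n + 1)) * (- 1) ^ k
          * (q ^ (k choose 2) * (q ^ n) ^ (2 * n + 1 - k)) * gauss_binomial q (2 * n + 1) k"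
      unfolding * by simp
    then show "(- 1) ^ n * q ^ e * (of_int (parity_sign (int k - int (n + 1)) * (2 * (int k - int (n + 1)) + 1))
          * q ^ tri (int k - int (n + 1)) * gauss_binomial q (2 * n + 1) k)
        = 2 * (of_nat (2 * n + 1 - k) * t k) - of_nat (2 * n + 1) * t k"
      unfolding t_def by (simp only: left_diff_distrib right_diff_distrib mult_ac)
  qed
  also have "\<dots> = 2 * (\<Sum>k\<le>2 * n + 1. of_nat (2 * n + 1 - k) * t k)"
    unfolding sum_subtractf sum_distrib_left[symmetric] sum0 by simp
  also have "\<dots> = 2 * (q ^ n * (\<Prod>i\<in>{..<2 * n + 1} - {n}. q ^ n + (- 1) * q ^ i))"
    unfolding t_def by (subst q_binomial_deriv) auto
  also have "\<dots> = 2 * (q ^ e * (\<Prod>i<n. (- 1) * (1 - q ^ Suc i)\<^sup>2))"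
    unfolding prod_off_centre e_def
    by (simp add: power2_eq_square algebra_simps)
  also have "(\<Prod>i<n. (- 1) * (1 - q ^ Suc i)\<^sup>2) = (- 1) ^ n * (qfac q n)\<^sup>2"
    by (simp only: prod.distrib prod_constant card_lessThan prod_power_distrib qfac_def)
  finally show ?thesis using assms by (simp add: mult_ac)
qed

text \<open>
  The \<open>q\<close>-binomial theorem in base \<open>q^2\<close> with \<open>x = -q\<close>, \<open>y = q^(2n)\<close>; the \<open>2n\<close> factors pair up
  symmetrically around the middle.
\<close>
lemma finite_gauss_square:
  fixes q :: "'a::idom"
  assumes "q \<noteq> 0"
  shows "(\<Sum>k\<le>2 * n. of_int (parity_sign (int k - int n)) * q ^ nat ((int k - int n)\<^sup>2) * gauss_binomial (q\<^sup>2) (2 * n) k)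
    = (\<Prod>i<n. 1 - q ^ (2 * i + 1))\<^sup>2"
proof -
  define e where "e = 3 * n * n"
  have "(- 1) ^ n * q ^ e * (\<Sum>k\<le>2 * n. of_int (parity_sign (int k - int n))
      * q ^ nat ((int k - int n)\<^sup>2) * gauss_binomial (q\<^sup>2) (2 * n) k)
      = (\<Sum>k\<le>2 * n. (q\<^sup>2) ^ (k choose 2) * gauss_binomial (q\<^sup>2) (2 * n) k * (- q) ^ k * (q ^ (2 * n)) ^ (2 * n - k))"
    unfolding sum_distrib_left
  proof (intro sum.cong refl)
    fix k assume k: "k \<in> {..2 * n}"
    define l where "l = 2 * n - k"
    have l: "int l = 2 * int n - int k" using k by (simp add: l_def)
    have "int (nat ((int k - int n)\<^sup>2)) = (int k - int n)\<^sup>2" by simp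
    then have "int (e + nat ((int k - int n)\<^sup>2)) = int (2 * (k choose 2) + k + 2 * n * l)"
      using choose_two_int[of k] unfolding of_nat_add
      by (simp add: e_def l power2_eq_square algebra_simps)
    then have *: "e + nat ((int k - int n)\<^sup>2) = 2 * (k choose 2) + k + 2 * n * (2 * n - k)"
      unfolding l_def by linarith
    have "(- 1) ^ n * of_int (parity_sign (int k - int n)) = ((- 1) ^ k :: 'a)"
      by (simp add: parity_sign_diff parity_sign_of_nat uminus_power_if)
    moreover have "q ^ e * q ^ nat ((int k - int n)\<^sup>2) = (q\<^sup>2) ^ (k choose 2) * q ^ k * (q ^ (2 * n)) ^ (2 * n - k)"
      by (simp add: * flip: power_add power_mult)
    ultimately have "((- 1) ^ n * of_int (parity_sign (int k - int n)))
          * (q ^ e * q ^ nat ((int k - int n)\<^sup>2)) * gauss_binomial (q\<^sup>2) (2 * n) k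
        = (- 1) ^ k * ((q\<^sup>2) ^ (k choose 2) * q ^ k * (q ^ (2 * n)) ^ (2 * n - k)) * gauss_binomial (q\<^sup>2) (2 * n) k"
      by simp
    then show "(- 1) ^ n * q ^ e * (of_int (parity_sign (int k - int n))
          * q ^ nat ((int k - int n)\<^sup>2) * gauss_binomial (q\<^sup>2) (2 * n) k)
        = (q\<^sup>2) ^ (k choose 2) * gauss_binomial (q\<^sup>2) (2 * n) k * (- q) ^ k * (q ^ (2 * n)) ^ (2 * n - k)"
      unfolding power_minus[of q k] by (simp only: mult_ac)
  qed
  also have "\<dots> = (\<Prod>i<n + n. q ^ (2 * n) + (- q) * (q\<^sup>2) ^ i)"
    unfolding q_binomial[symmetric] mult_2 ..
  also have "\<dots> = (\<Prod>i<n. q ^ (2 * n) + (- q) * (q\<^sup>2) ^ (n - Suc i)) * (\<Prod>i<n. q ^ (2 * n) + (- q) * (q\<^sup>2) ^ (n + i))"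
    by (rule prod_lessThan_add_reversed)
  also have "(\<Prod>i<n. q ^ (2 * n) + (- q) * (q\<^sup>2) ^ (n - Suc i))
      = (\<Prod>i<n. ((- 1) * q ^ (2 * (n - Suc i) + 1)) * (1 - q ^ (2 * i + 1)))"
  proof (intro prod.cong refl)
    fix i assume "i \<in> {..<n}"
    then have "2 * n = (2 * (n - Suc i) + 1) + (2 * i + 1)" by auto
    then have "q ^ (2 * n) = q ^ (2 * (n - Suc i) + 1) * q ^ (2 * i + 1)"
      by (metis power_add)
    then show "q ^ (2 * n) + (- q) * (q\<^sup>2) ^ (n - Suc i) = ((- 1) * q ^ (2 * (n - Suc i) + 1)) * (1 - q ^ (2 * i + 1))"
      by (simp add: algebra_simps flip: power_mult)
  qed
  also have "\<dots> = (- 1) ^ n * q ^ (n * n) * (\<Prod>i<n. 1 - q ^ (2 * i + 1))"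
  proof -
    have "(\<Sum>i<n. 2 * (n - Suc i) + 1) = (\<Sum>i<n. 2 * i + 1)"
      by (rule sum.nat_diff_reindex)
    also have "\<dots> = n * n" by (induction n) auto
    finally show ?thesis
      by (simp only: prod.distrib prod_constant card_lessThan power_sum[symmetric])
  qed
  also have "(\<Prod>i<n. q ^ (2 * n) + (- q) * (q\<^sup>2) ^ (n + i)) = (\<Prod>i<n. q ^ (2 * n) * (1 - q ^ (2 * i + 1)))"
    by (intro prod.cong refl) (simp add: algebra_simps power_add flip: power_mult)
  also have "\<dots> = q ^ (2 * n * n) * (\<Prod>i<n. 1 - q ^ (2 * i + 1))"
    by (simp add: prod.distrib power_mult)
  finally have "(- 1) ^ n * q ^ e * (\<Sum>k\<le>2 * n. of_int (parity_sign (int k - int n))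
      * q ^ nat ((int k - int n)\<^sup>2) * gauss_binomial (q\<^sup>2) (2 * n) k)
      = (- 1) ^ n * q ^ e * (\<Prod>i<n. 1 - q ^ (2 * i + 1))\<^sup>2"
    by (simp add: e_def power2_eq_square mult_ac flip: power_add)
  then show ?thesis using assms by simp
qed

section \<open>Theta series as limits of finite identities\<close>

text \<open>
  The sum of \<open>w i q^(e i)\<close> over all \<open>i\<close>, for arbitrary index types, so that products of series become
  series indexed by pairs.  It is meaningful if every value of \<open>e\<close> is taken finitely often.
\<close>
definition theta :: "('i \<Rightarrow> int) \<Rightarrow> ('i \<Rightarrow> nat) \<Rightarrow> int fps" where
  "theta w e = Abs_fps (\<lambda>n. \<Sum>i | e i = n. w i)"

lemma finite_fibre:
  fixes e :: "int \<Rightarrow> nat"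
  assumes "\<And>i. \<bar>i\<bar> \<le> int (e i) + 1"
  shows "finite {i. e i = n}"
proof (rule finite_subset)
  show "{i. e i = n} \<subseteq> {- int n - 1..int n + 1}"
  proof
    fix i assume "i \<in> {i. e i = n}"
    then show "i \<in> {- int n - 1..int n + 1}" using assms[of i] by auto
  qed
qed simp

lemma theta_mult:
  assumes "\<And>n. finite {i. e i = n}" "\<And>n. finite {j. e' j = n}"
  shows "theta w e * theta w' e' = theta (\<lambda>(i, j). w i * w' j) (\<lambda>(i, j). e i + e' j)"
proof (rule fps_ext)
  fix n
  have "fps_nth (theta w e * theta w' e') n
      = (\<Sum>m\<in>{0..n}. \<Sum>(i, j)\<in>{i. e i = m} \<times> {j. e' j = n - m}. w i * w' j)"
    by (simp add: theta_def fps_mult_nth sum_product sum.cartesian_product)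
  also have "\<dots> = (\<Sum>(m, i, j)\<in>(SIGMA m:{0..n}. {i. e i = m} \<times> {j. e' j = n - m}). w i * w' j)"
    by (subst sum.Sigma) (auto simp: assms)
  also have "\<dots> = (\<Sum>(i, j) | e i + e' j = n. w i * w' j)"
    by (rule sum.reindex_bij_witness[of _ "\<lambda>(i, j). (e i, i, j)" snd]) auto
  also have "{(i, j). e i + e' j = n} = {ij. (\<lambda>(i, j). e i + e' j) ij = n}"
    by auto
  finally show "fps_nth (theta w e * theta w' e') n
      = fps_nth (theta (\<lambda>(i, j). w i * w' j) (\<lambda>(i, j). e i + e' j)) n"
    by (simp add: theta_def)
qed

lemma finite_fibre_prod:
  fixes e :: "'i \<Rightarrow> nat" and e' :: "'j \<Rightarrow> nat"
  assumes "\<And>n. finite {i. e i = n}" "\<And>n. finite {j. e' j = n}"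
  shows "finite {ij. (\<lambda>(i, j). e i + e' j) ij = n}"
proof (rule finite_subset)
  show "{ij. (\<lambda>(i, j). e i + e' j) ij = n}
      \<subseteq> (\<Union>m\<le>n. {i. e i = m}) \<times> (\<Union>m\<le>n. {j. e' j = m})"
    by auto
  show "finite ((\<Union>m\<le>n. {i. e i = m}) \<times> (\<Union>m\<le>n. {j. e' j = m}))"
    using assms by auto
qed

lemma theta_mod_X_power:
  fixes e :: "int \<Rightarrow> nat" and M N :: nat
  assumes growth: "\<And>i. \<bar>i\<bar> \<le> int (e i) + 1" and "n \<le> M" "M + n \<le> N"
  shows "fps_X ^ n dvd theta w e
    - (\<Sum>k\<le>N. of_int (w (int k - int M)) * fps_X ^ e (int k - int M))"
  unfolding fps_X_power_dvd_iff
proof (intro allI impI)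
  fix m assume "m < n"
  let ?h = "\<lambda>k. int k - int M"
  have "fps_nth (\<Sum>k\<le>N. of_int (w (?h k)) * fps_X ^ e (?h k)) m
      = (\<Sum>k\<le>N. if e (?h k) = m then w (?h k) else 0)"
    by (auto simp: fps_sum_nth fps_X_power_nth fps_of_int[symmetric]
        intro!: sum.cong simp del: fps_of_int)
  also have "\<dots> = (\<Sum>k | k \<le> N \<and> e (?h k) = m. w (?h k))"
    by (intro sum.mono_neutral_cong_right) auto
  also have "\<dots> = (\<Sum>i | e i = m. w i)"
  proof (rule sum.reindex_bij_witness[of _ "\<lambda>i. nat (i + int M)" ?h])
    fix i assume "i \<in> {i. e i = m}"
    then have "\<bar>i\<bar> \<le> int m + 1" using growth[of i] by simp
    then have "- int M \<le> i" "i \<le> int N - int M" using assms(2,3) \<open>m < n\<close> by linarith+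
    then show "int (nat (i + int M)) - int M = i" "nat (i + int M) \<in> {k. k \<le> N \<and> e (?h k) = m}"
      using \<open>i \<in> _\<close> by auto
  qed auto
  finally show "fps_nth (theta w e
    - (\<Sum>k\<le>N. of_int (w (?h k)) * fps_X ^ e (?h k))) m = 0"
    by (simp add: theta_def)
qed

text \<open>
  Passage to the limit.  The \<open>k\<close>-th Gaussian binomial, multiplied by \<open>qpoch a\<close>, is 1 up to an error
  divisible by a power of \<open>fps_X\<close> whose exponent is one more than the distance of \<open>k\<close> from the nearer end of
  the range.  Near the ends the error is large, but there \<open>e\<close> is large as well; the growth condition
  makes the two exponents add up to at least \<open>n\<close>.
\<close>
lemma theta_eqI:
  fixes e :: "int \<Rightarrow> nat" and M N :: "nat \<Rightarrow> nat"
  assumes growth: "\<And>i. \<bar>i\<bar> \<le> int (e i) + 1" and "a \<ge> 1"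
    and M: "\<And>n. n \<le> M n" and N: "\<And>n. M n + n \<le> N n"
    and lim: "\<And>n. fps_X ^ n dvd qpoch a * (\<Sum>k\<le>N n. of_int (w (int k - int (M n)))
      * fps_X ^ e (int k - int (M n)) * gauss_binomial (fps_X ^ a) (N n) k) - H"
  shows "theta w e = H"
proof (rule fps_eqI_mod_X_power)
  fix n
  let ?h = "\<lambda>k. int k - int (M n)"
  let ?t = "\<lambda>k. of_int (w (?h k)) * fps_X ^ e (?h k) :: int fps"
  have "fps_X ^ n dvd ?t k * (qpoch a * gauss_binomial (fps_X ^ a) (N n) k - 1)" if "k \<le> N n" for k
  proof -
    have "fps_X ^ Suc (min k (N n - k)) dvd qpoch a * gauss_binomial (fps_X ^ a) (N n) k - 1"
      using gauss_binomial_mod_X_power[OF \<open>a \<ge> 1\<close>, of k "N n - k"] that by simp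
    then have "fps_X ^ e (?h k) * fps_X ^ Suc (min k (N n - k))
        dvd ?t k * (qpoch a * gauss_binomial (fps_X ^ a) (N n) k - 1)"
      by (intro mult_dvd_mono) auto
    moreover have "n \<le> e (?h k) + Suc (min k (N n - k))"
      using growth[of "?h k"] M[of n] N[of n] that by linarith
    ultimately show ?thesis
      unfolding power_add[symmetric] by (rule power_le_dvd)
  qed
  then have "fps_X ^ n dvd (\<Sum>k\<le>N n. ?t k * (qpoch a * gauss_binomial (fps_X ^ a) (N n) k - 1))"
    by (intro dvd_sum) auto
  also have "(\<Sum>k\<le>N n. ?t k * (qpoch a * gauss_binomial (fps_X ^ a) (N n) k - 1))
      = qpoch a * (\<Sum>k\<le>N n. ?t k * gauss_binomial (fps_X ^ a) (N n) k) - (\<Sum>k\<le>N n. ?t k)"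
    by (simp add: right_diff_distrib sum_subtractf sum_distrib_left mult_ac)
  finally have "fps_X ^ n dvd qpoch a * (\<Sum>k\<le>N n. ?t k * gauss_binomial (fps_X ^ a) (N n) k) - (\<Sum>k\<le>N n. ?t k)" .
  from dvd_diff[OF lim[of n] this] have "fps_X ^ n dvd (\<Sum>k\<le>N n. ?t k) - H"
    by simp
  with theta_mod_X_power[OF growth M N, where w = w]
  show "fps_X ^ n dvd theta w e - H"
    by (rule dvd_diff_trans)
qed

section \<open>The series of Jacobi and Gauss\<close>

definition jacobi_cube :: "int fps" where
  "jacobi_cube = theta (\<lambda>k. parity_sign k * (2 * k + 1)) tri"

definition gauss_square :: "int fps" where
  "gauss_square = theta parity_sign (\<lambda>k. nat (k\<^sup>2))"

definition gauss_triangular :: "int fps" where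
  "gauss_triangular = theta (\<lambda>_. 1) tri"

lemma jacobi_cube_eq: "jacobi_cube = 2 * qpoch 1 ^ 3"
  unfolding jacobi_cube_def
proof (rule theta_eqI[where a = 1 and M = "\<lambda>n. n + 1" and N = "\<lambda>n. 2 * n + 1"])
  fix n
  have "fps_X ^ n dvd qpoch 1 - qfac (fps_X ^ 1) n"
    by (rule qpoch_mod_X_power) auto
  then have "fps_X ^ n dvd qfac (fps_X ^ 1) n - qpoch 1"
    by (rule dvd_diff_sym)
  then have "fps_X ^ n dvd (2 * qpoch 1) * (qfac (fps_X ^ 1) n)\<^sup>2 - (2 * qpoch 1) * (qpoch 1)\<^sup>2"
    by (intro dvd_diff_mult dvd_diff_power) auto
  then show "fps_X ^ n dvd qpoch 1 * (\<Sum>k\<le>2 * n + 1. of_int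
      (parity_sign (int k - int (n + 1)) * (2 * (int k - int (n + 1)) + 1))
      * fps_X ^ tri (int k - int (n + 1)) * gauss_binomial (fps_X ^ 1) (2 * n + 1) k) - 2 * qpoch 1 ^ 3"
    unfolding power_one_right finite_jacobi[OF fps_X_neq_zero]
    by (simp only: power2_eq_square power3_eq_cube mult_ac)
qed (auto simp: tri_growth)

text \<open>
  The finite product times \<open>qpoch 1\<close> is \<open>qpoch 2\<close> in the limit, as \<open>(1 + x)(1 - x) = 1 - x^2\<close>.
\<close>
lemma gauss_triangular_eq: "gauss_triangular * qpoch 1 = 2 * (qpoch 2)\<^sup>2"
proof -
  obtain G where G: "G * qpoch 1 = 1" using qpoch_inverse[of 1] by auto
  have eq: "gauss_triangular = 2 * (qpoch 2)\<^sup>2 * G"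
    unfolding gauss_triangular_def
  proof (rule theta_eqI[where a = 1 and M = "\<lambda>n. n + 1" and N = "\<lambda>n. 2 * n + 1"])
    fix n
    define P where "P = (\<Prod>i<n. 1 + fps_X ^ Suc i :: int fps)"
    have P: "P * qfac (fps_X ^ 1) n = qfac (fps_X ^ 2) n"
      unfolding P_def qfac_def prod.distrib[symmetric]
    proof (intro prod.cong refl)
      fix i
      have "((fps_X :: int fps) ^ 2) ^ Suc i = (fps_X ^ Suc i) ^ 2"
        by (simp only: power_mult[symmetric] mult.commute)
      then show "(1 + fps_X ^ Suc i) * (1 - (fps_X ^ 1) ^ Suc i) = (1 - ((fps_X :: int fps) ^ 2) ^ Suc i)"
        by (simp add: power2_eq_square algebra_simps del: power_Suc)
    qed
    have "fps_X ^ n dvd P * qpoch 1 - P * qfac (fps_X ^ 1) n"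
      by (intro dvd_diff_mult qpoch_mod_X_power) auto
    moreover have "fps_X ^ n dvd qpoch 2 - qfac (fps_X ^ 2) n"
      by (rule qpoch_mod_X_power) auto
    ultimately have "fps_X ^ n dvd P * qpoch 1 - qpoch 2"
      unfolding P by (blast intro: dvd_diff_trans dvd_diff_sym)
    then have "fps_X ^ n dvd (2 * G) * (P * qpoch 1)\<^sup>2 - (2 * G) * (qpoch 2)\<^sup>2"
      by (intro dvd_diff_mult dvd_diff_power) auto
    also have "(2 * G) * (P * qpoch 1)\<^sup>2 = qpoch 1 * (2 * P\<^sup>2) * (G * qpoch 1)"
      by (simp add: power2_eq_square mult_ac)
    finally show "fps_X ^ n dvd qpoch 1 * (\<Sum>k\<le>2 * n + 1. of_int 1
        * fps_X ^ tri (int k - int (n + 1)) * gauss_binomial (fps_X ^ 1) (2 * n + 1) k) - 2 * (qpoch 2)\<^sup>2 * G"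
      unfolding of_int_1 mult_1_left power_one_right finite_triangular[OF fps_X_neq_zero]
        P_def[symmetric] G by (simp only: mult_1_left mult_1_right mult_ac)
  qed (auto simp: tri_growth)
  show ?thesis unfolding eq by (simp only: G mult.assoc mult_1_right)
qed

text \<open>
  The finite product runs over odd exponents, and completing it by the even ones in \<open>qpoch 2\<close> gives
  \<open>qpoch 1\<close>.
\<close>
lemma gauss_square_eq: "gauss_square * qpoch 2 = (qpoch 1)\<^sup>2"
proof -
  obtain G where G: "G * qpoch 2 = 1" using qpoch_inverse[of 2] by auto
  have eq: "gauss_square = (qpoch 1)\<^sup>2 * G"
    unfolding gauss_square_def
  proof (rule theta_eqI[where a = 2 and M = "\<lambda>n. n" and N = "\<lambda>n. 2 * n"])
    fix n
    define P where "P = (\<Prod>i<n. 1 - fps_X ^ (2 * i + 1) :: int fps)"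
    have P: "P * qfac (fps_X ^ 2) n = qfac (fps_X ^ 1) (2 * n)"
      unfolding P_def
    proof (induction n)
      case (Suc n)
      have "((fps_X :: int fps) ^ 2) ^ Suc n = fps_X ^ Suc (Suc (2 * n))"
        by (simp add: power_mult[symmetric] del: power_Suc)
      then show ?case
        using Suc.IH by (simp add: qfac_Suc mult_ac del: power_Suc)
    qed simp
    have "fps_X ^ n dvd P * qpoch 2 - P * qfac (fps_X ^ 2) n"
      by (intro dvd_diff_mult qpoch_mod_X_power) auto
    moreover have "fps_X ^ n dvd qpoch 1 - qfac (fps_X ^ 1) (2 * n)"
      by (rule qpoch_mod_X_power) auto
    ultimately have "fps_X ^ n dvd P * qpoch 2 - qpoch 1"
      unfolding P by (blast intro: dvd_diff_trans dvd_diff_sym)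
    then have "fps_X ^ n dvd G * (P * qpoch 2)\<^sup>2 - G * (qpoch 1)\<^sup>2"
      by (intro dvd_diff_mult dvd_diff_power) auto
    also have "G * (P * qpoch 2)\<^sup>2 = qpoch 2 * P\<^sup>2 * (G * qpoch 2)"
      by (simp add: power2_eq_square mult_ac)
    finally show "fps_X ^ n dvd qpoch 2 * (\<Sum>k\<le>2 * n. of_int (parity_sign (int k - int n))
        * fps_X ^ nat ((int k - int n)\<^sup>2) * gauss_binomial (fps_X ^ 2) (2 * n) k) - (qpoch 1)\<^sup>2 * G"
      unfolding finite_gauss_square[OF fps_X_neq_zero] G P_def by (simp add: mult_ac)
  qed (rule square_growth, auto)
  show ?thesis unfolding eq by (simp only: G mult.assoc mult_1_right)
qed

text \<open>
  In terms of products, \<open>(f_1^2 / f_2)^2 \<cdot> 2 f_2^2 / f_1 = 2 f_1^3\<close>.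
\<close>
lemma ternary_eq_jacobi_cube: "gauss_square\<^sup>2 * gauss_triangular = jacobi_cube"
proof -
  obtain G1 where G1: "G1 * qpoch 1 = 1" using qpoch_inverse[of 1] by auto
  obtain G2 where G2: "G2 * qpoch 2 = 1" using qpoch_inverse[of 2] by auto
  have "gauss_square\<^sup>2 * gauss_triangular
      = gauss_square\<^sup>2 * gauss_triangular * (G2 * qpoch 2)\<^sup>2 * (G1 * qpoch 1)"
    by (simp only: G1 G2 power_one mult_1_right)
  also have "\<dots> = (gauss_square * qpoch 2)\<^sup>2 * (gauss_triangular * qpoch 1) * G2\<^sup>2 * G1"
    by (simp add: power2_eq_square mult_ac)
  also have "\<dots> = 2 * qpoch 1 ^ 3 * (G2 * qpoch 2)\<^sup>2 * (G1 * qpoch 1)"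
    unfolding gauss_square_eq gauss_triangular_eq
    by (simp add: power2_eq_square power3_eq_cube mult_ac)
  finally show ?thesis by (simp only: G1 G2 jacobi_cube_eq power_one mult_1_right)
qed

section \<open>Reduction of the generating function modulo 9\<close>

text \<open>
  Factorwise \<open>(1 - x)^3 \<equiv> 1 - x^3\<close> modulo 3, hence \<open>f_1^3 \<equiv> f_3\<close> modulo 3, and cubing lifts a congruence
  modulo 3 to one modulo 9.
\<close>
lemma nine_dvd_qpoch_diff: "9 dvd qpoch 3 ^ 3 - qpoch 1 ^ 9"
proof -
  have "3 dvd fps_nth (qpoch 3 - qpoch 1 ^ 3) n" for n
  proof -
    have "3 dvd qfac (fps_X ^ 3 :: int fps) (Suc n) - qfac (fps_X ^ 1) (Suc n) ^ 3"
      unfolding qfac_def prod_power_distrib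
    proof (rule dvd_diff_prod)
      fix i
      have "1 - (fps_X ^ 3) ^ Suc i - (1 - (fps_X ^ 1) ^ Suc i) ^ 3
          = (3 :: int fps) * (fps_X ^ Suc i - (fps_X ^ Suc i)\<^sup>2)"
      proof -
        have "((fps_X :: int fps) ^ 3) ^ Suc i = (fps_X ^ Suc i) ^ 3"
          by (simp only: power_mult[symmetric] mult.commute)
        then show ?thesis
          by (simp add: power2_eq_square power3_eq_cube algebra_simps del: power_Suc)
      qed
      then show "(3 :: int fps) dvd 1 - (fps_X ^ 3) ^ Suc i - (1 - (fps_X ^ 1) ^ Suc i) ^ 3"
        by (rule dvdI)
    qed
    then obtain h where h: "qfac (fps_X ^ 3 :: int fps) (Suc n) - qfac (fps_X ^ 1) (Suc n) ^ 3 = 3 * h" by (rule dvdE)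
    have "fps_X ^ Suc n dvd qpoch 3 - qfac (fps_X ^ 3) (Suc n)"
      by (intro qpoch_mod_X_power) simp_all
    moreover have "fps_X ^ Suc n dvd qpoch 1 ^ 3 - qfac (fps_X ^ 1) (Suc n) ^ 3"
      by (intro dvd_diff_power qpoch_mod_X_power) simp_all
    ultimately have "fps_X ^ Suc n dvd (qpoch 3 - qfac (fps_X ^ 3) (Suc n)) - (qpoch 1 ^ 3 - qfac (fps_X ^ 1) (Suc n) ^ 3)"
      by (rule dvd_diff)
    then have "fps_X ^ Suc n dvd (qpoch 3 - qpoch 1 ^ 3) - 3 * h"
      unfolding h[symmetric] by (simp add: algebra_simps del: power_Suc)
    then have "fps_nth (qpoch 3 - qpoch 1 ^ 3) n = 3 * fps_nth h n"
      by (simp add: fps_X_power_dvd_iff numeral_fps_const del: power_Suc)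
    then show ?thesis by simp
  qed
  then have "qpoch 3 - qpoch 1 ^ 3 = 3 * Abs_fps (\<lambda>n. fps_nth (qpoch 3 - qpoch 1 ^ 3) n div 3)"
    by (intro fps_ext) (simp add: numeral_fps_const)
  then have "3 dvd qpoch 3 - qpoch 1 ^ 3" by (rule dvdI)
  from nine_dvd_cube_diff[OF this] show ?thesis by (simp flip: power_mult)
qed

text \<open>
  The factor 4 avoids halving: \<open>jacobi_cube\<close> is twice the cube of \<open>qpoch 1\<close> and enters squared.
\<close>
lemma d_generating_function_mod_9: "9 dvd 4 * Abs_fps d - jacobi_cube\<^sup>2 * gauss_square"
proof -
  have "qpoch 1 * (qpoch 2 * (4 * Abs_fps d - jacobi_cube\<^sup>2 * gauss_square))
      = 4 * (Abs_fps d * (qpoch 1 * qpoch 2)) - qpoch 1 * jacobi_cube\<^sup>2 * (gauss_square * qpoch 2)"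
    by (simp add: algebra_simps)
  also have "\<dots> = 4 * (qpoch 3 ^ 3 - qpoch 1 ^ 9)"
    unfolding d_generating_function gauss_square_eq jacobi_cube_eq
    by (simp add: algebra_simps flip: power_mult power_add power_Suc)
  finally have "9 dvd qpoch 1 * (qpoch 2 * (4 * Abs_fps d - jacobi_cube\<^sup>2 * gauss_square))"
    using nine_dvd_qpoch_diff by (simp only: dvd_mult)
  then show ?thesis by (simp add: dvd_qpoch_mult_iff)
qed

section \<open>Signed counts of solutions of a ternary quadratic equation\<close>

definition ternary :: "int \<Rightarrow> (int \<times> int \<times> int) set" where
  "ternary m = {(u, w, y). odd y \<and> 8 * u\<^sup>2 + 8 * w\<^sup>2 + y\<^sup>2 = m}"

lemma finite_ternary: "finite (ternary m)"
proof (rule finite_subset)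
  have bound: "\<bar>x\<bar> \<le> \<bar>m\<bar>" if "x\<^sup>2 \<le> m" for x m :: int
  proof -
    have "\<bar>x\<bar> \<le> x\<^sup>2"
      using self_le_power[of "\<bar>x\<bar>" 2] by (cases "x = 0") auto
    then show ?thesis using that by linarith
  qed
  show "ternary m \<subseteq> {- \<bar>m\<bar>..\<bar>m\<bar>} \<times> {- \<bar>m\<bar>..\<bar>m\<bar>} \<times> {- \<bar>m\<bar>..\<bar>m\<bar>}"
  proof
    fix t assume "t \<in> ternary m"
    then obtain u w y where t: "t = (u, w, y)" and m: "8 * u\<^sup>2 + 8 * w\<^sup>2 + y\<^sup>2 = m"
      by (auto simp: ternary_def)
    have "0 \<le> u\<^sup>2" "0 \<le> w\<^sup>2" "0 \<le> y\<^sup>2" by simp_all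
    then have "u\<^sup>2 \<le> m" "w\<^sup>2 \<le> m" "y\<^sup>2 \<le> m" using m by linarith+
    from this[THEN bound] show "t \<in> {- \<bar>m\<bar>..\<bar>m\<bar>} \<times> {- \<bar>m\<bar>..\<bar>m\<bar>} \<times> {- \<bar>m\<bar>..\<bar>m\<bar>}"
      unfolding t by (auto simp: abs_le_iff)
  qed
qed auto

text \<open>
  The signed counts are the coefficients of \<open>gauss_square\<^sup>2 * gauss_triangular\<close>, which is \<open>jacobi_cube\<close>;
  its coefficient at \<open>n\<close> vanishes unless \<open>8 n + 1\<close>, here \<open>m\<close>, is a square.
\<close>
lemma sum_ternary_eq_0:
  assumes "\<nexists>s. m = s\<^sup>2"
  shows "(\<Sum>(u, w, y)\<in>ternary m. parity_sign (u + w)) = 0"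
proof (cases "ternary m = {}")
  case False
  then obtain u0 w0 y0 where y0: "odd y0" "8 * u0\<^sup>2 + 8 * w0\<^sup>2 + y0\<^sup>2 = m"
    by (auto simp: ternary_def)
  obtain b0 where b0: "y0 = 2 * b0 + 1" using y0(1) by (rule oddE)
  define n where "n = nat (u0\<^sup>2) + nat (w0\<^sup>2) + tri b0"
  have m: "m = 8 * int n + 1"
    using y0(2) int_tri[of b0] by (simp add: n_def b0)
  have fin: "finite {i :: int. nat (i\<^sup>2) = n}" "finite {i. tri i = n}" for n
    by (rule finite_fibre, rule square_growth, rule finite_fibre, rule tri_growth)
  have "gauss_square\<^sup>2 * gauss_triangular = gauss_square * (gauss_square * gauss_triangular)"
    by (simp add: power2_eq_square mult.assoc)
  also have "\<dots> = theta (\<lambda>(u, w, b). parity_sign u * (parity_sign w * 1))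
      (\<lambda>(u, w, b). nat (u\<^sup>2) + (nat (w\<^sup>2) + tri b))"
    unfolding gauss_square_def gauss_triangular_def
    by (subst theta_mult, (rule fin)+, subst theta_mult, rule fin, rule finite_fibre_prod, (rule fin)+)
      (simp add: case_prod_unfold)
  finally have eq: "jacobi_cube = \<dots>"
    unfolding ternary_eq_jacobi_cube .
  have "fps_nth jacobi_cube n
      = (\<Sum>(u, w, b) | nat (u\<^sup>2) + (nat (w\<^sup>2) + tri b) = n. parity_sign (u + w))"
    unfolding eq by (simp add: theta_def case_prod_unfold parity_sign_add)
  also have "\<dots> = (\<Sum>(u, w, y)\<in>ternary m. parity_sign (u + w))"
  proof (rule sum.reindex_bij_witness[of _ "\<lambda>(u, w, y). (u, w, (y - 1) div 2)" "\<lambda>(u, w, b). (u, w, 2 * b + 1)"])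
    have eq: "nat (u\<^sup>2) + (nat (w\<^sup>2) + tri b) = n
        \<longleftrightarrow> 8 * u\<^sup>2 + 8 * w\<^sup>2 + (2 * b + 1)\<^sup>2 = m" for u w b :: int
    proof -
      have "int (nat (u\<^sup>2) + (nat (w\<^sup>2) + tri b)) = u\<^sup>2 + w\<^sup>2 + int (tri b)" by simp
      then show ?thesis using int_tri[of b] unfolding m by linarith
    qed
    show "(case a of (u, w, b) \<Rightarrow> (u, w, 2 * b + 1)) \<in> ternary m"
      if "a \<in> {(u, w, b). nat (u\<^sup>2) + (nat (w\<^sup>2) + tri b) = n}" for a
      using that eq by (auto simp: ternary_def)
    show "(case a of (u, w, y) \<Rightarrow> (u, w, (y - 1) div 2)) \<in> {(u, w, b). nat (u\<^sup>2) + (nat (w\<^sup>2) + tri b) = n}"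
      if "a \<in> ternary m" for a
      using that eq by (auto simp: ternary_def elim!: oddE)
  qed (auto simp: ternary_def elim!: oddE)
  also have "fps_nth jacobi_cube n = 0"
  proof -
    have "{k. tri k = n} = {}" using assms unfolding m tri_eq_iff by (metis (mono_tags, lifting) Collect_empty_eq)
    then show ?thesis by (simp add: jacobi_cube_def theta_def)
  qed
  finally show ?thesis by simp
qed simp

lemma square_mod_3: "(x :: int)\<^sup>2 mod 3 = (if 3 dvd x then 0 else 1)"
proof -
  have "x mod 3 = 0 \<or> x mod 3 = 1 \<or> x mod 3 = 2" by presburger
  moreover have "x\<^sup>2 mod 3 = (x mod 3)\<^sup>2 mod 3"
    by (rule power_mod[symmetric])
  ultimately show ?thesis
    unfolding dvd_eq_mod_eq_0 by (elim disjE) (simp_all only:, simp_all)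
qed

text \<open>
  Modulo 3 the weight \<open>y^2\<close> is 1 minus the indicator of \<open>3 dvd y\<close>.  The constant 1 contributes the
  signed count for \<open>m\<close>.  Where 3 divides \<open>y\<close>, also \<open>u^2 + w^2\<close> is divisible by 3, hence so are \<open>u\<close> and
  \<open>w\<close>, and the indicator contributes the signed count for \<open>m / 9\<close>.
\<close>
lemma weighted_sum_ternary:
  assumes "\<nexists>s. m = s\<^sup>2" and "3 dvd m"
  shows "3 dvd (\<Sum>(u, w, y)\<in>ternary m. parity_sign (u + w) * y\<^sup>2)"
proof -
  define T where "T = {(u, w, y) \<in> ternary m. 3 dvd y}"
  have "3 dvd (\<Sum>(u, w, y)\<in>ternary m. parity_sign (u + w) * y\<^sup>2
      - (parity_sign (u + w) - (if 3 dvd y then parity_sign (u + w) else 0)))"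
  proof (rule dvd_sum)
    fix t :: "int \<times> int \<times> int"
    obtain u w y where t: "t = (u, w, y)" by (cases t)
    have "3 dvd y\<^sup>2 - (if 3 dvd y then 0 else 1)"
      using square_mod_3[of y] by (metis dvd_minus_mod)
    then have "3 dvd parity_sign (u + w) * (y\<^sup>2 - (if 3 dvd y then 0 else 1))" by simp
    then show "3 dvd (case t of (u, w, y) \<Rightarrow> parity_sign (u + w) * y\<^sup>2
        - (parity_sign (u + w) - (if 3 dvd y then parity_sign (u + w) else 0)))"
      unfolding t by (auto simp: algebra_simps split: if_splits)
  qed
  also have "(\<Sum>(u, w, y)\<in>ternary m. parity_sign (u + w) * y\<^sup>2
        - (parity_sign (u + w) - (if 3 dvd y then parity_sign (u + w) else 0)))
      = (\<Sum>(u, w, y)\<in>ternary m. parity_sign (u + w) * y\<^sup>2)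
        - ((\<Sum>(u, w, y)\<in>ternary m. parity_sign (u + w))
          - (\<Sum>(u, w, y)\<in>ternary m. if 3 dvd y then parity_sign (u + w) else 0))"
    by (simp add: case_prod_unfold sum_subtractf)
  also have "(\<Sum>(u, w, y)\<in>ternary m. if 3 dvd y then parity_sign (u + w) else 0)
      = (\<Sum>(u, w, y)\<in>T. parity_sign (u + w))"
    unfolding T_def case_prod_unfold
    by (intro sum.mono_neutral_cong_right finite_ternary) auto
  also have "\<dots> = 0"
  proof (cases "T = {}")
    case False
    have div3: "3 dvd u \<and> 3 dvd w" if "(u, w, y) \<in> T" for u w y
    proof -
      have "3 dvd y" and m: "m = 8 * u\<^sup>2 + 8 * w\<^sup>2 + y\<^sup>2" using that by (auto simp: T_def ternary_def)
      have "(u\<^sup>2 + w\<^sup>2) mod 3 = 0"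
        using \<open>3 dvd m\<close> square_mod_3[of y] \<open>3 dvd y\<close> unfolding m by simp presburger
      then show ?thesis
        using square_mod_3[of u] square_mod_3[of w] mod_add_eq[of "u\<^sup>2" 3 "w\<^sup>2"]
        by (auto split: if_splits)
    qed
    have tripled: "\<exists>u w y. t = (3 * u, 3 * w, 3 * y)" if "t \<in> T" for t
    proof -
      obtain u w y where t: "t = (u, w, y)" by (cases t)
      have "3 dvd u" "3 dvd w" "3 dvd y"
        using div3[of u w y] that by (auto simp: t T_def)
      then show ?thesis unfolding t dvd_def by blast
    qed
    then obtain u w y where "(3 * u, 3 * w, 3 * y) \<in> T"
      using False by blast
    then have m: "m = 9 * (8 * u\<^sup>2 + 8 * w\<^sup>2 + y\<^sup>2)"
      by (auto simp: T_def ternary_def)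
    define m' where "m' = 8 * u\<^sup>2 + 8 * w\<^sup>2 + y\<^sup>2"
    have m': "m = 9 * m'" unfolding m m'_def ..
    have "\<nexists>s. m' = s\<^sup>2"
    proof
      assume "\<exists>s. m' = s\<^sup>2"
      then have "\<exists>s. m = (3 * s)\<^sup>2" unfolding m' by auto
      then show False using assms(1) by blast
    qed
    then have "0 = (\<Sum>(u, w, y)\<in>ternary m'. parity_sign (u + w))"
      by (simp add: sum_ternary_eq_0)
    also have "\<dots> = (\<Sum>(u, w, y)\<in>T. parity_sign (u + w))"
    proof (rule sum.reindex_bij_witness[of _ "\<lambda>(u, w, y). (u div 3, w div 3, y div 3)" "\<lambda>(u, w, y). (3 * u, 3 * w, 3 * y)"])
      fix t assume t: "t \<in> T"
      obtain u w y where t_eq: "t = (3 * u, 3 * w, 3 * y)"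
        using tripled[OF t] by blast
      show "(case t of (u, w, y) \<Rightarrow> (u div 3, w div 3, y div 3)) \<in> ternary m'"
        "(case case t of (u, w, y) \<Rightarrow> (u div 3, w div 3, y div 3) of (u, w, y) \<Rightarrow> (3 * u, 3 * w, 3 * y)) = t"
        using t unfolding t_eq by (auto simp: T_def ternary_def m')
    qed (auto simp: T_def ternary_def m' parity_sign_def)
    finally show ?thesis by simp
  qed simp
  finally show ?thesis
    by (simp add: sum_ternary_eq_0[OF assms(1)])
qed

section \<open>The coefficients modulo 9\<close>

text \<open>
  Two rotations by 45 degrees (up to scaling) and two symmetries of the sum over \<open>(a, k, l)\<close>; evenness of \<open>N\<close> makes \<open>a\<close>
  and \<open>c\<close> have equal parity, which allows exchanging them and applying the second rotation.
\<close>
lemma d_mod_9_ternary: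
  assumes "even N"
  defines "m \<equiv> 4 * int N + 1"
  shows "9 dvd 4 * d N - (\<Sum>(u, w, y)\<in>ternary m. parity_sign (u + w) * (3 * y\<^sup>2 - m))"
proof -
  have fin: "finite {i :: int. nat (i\<^sup>2) = n}" "finite {i. tri i = n}" for n
    by (rule finite_fibre, rule square_growth, rule finite_fibre, rule tri_growth)
  define g where "g a k l = parity_sign (a + k + l) * ((2 * k + 1) * (2 * l + 1))" for a k l
  define A where "A = {(a, k, l). 8 * a\<^sup>2 + (2 * k + 1)\<^sup>2 + (2 * l + 1)\<^sup>2 = 2 * m}"
  define U where "U = {(a, b, c). 4 * a\<^sup>2 + (2 * b + 1)\<^sup>2 + 4 * c\<^sup>2 = m}"
  define S where "S = (\<Sum>(a, b, c)\<in>U. parity_sign a * ((2 * b + 1)\<^sup>2 - 4 * c\<^sup>2))"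

  have par: "even (a + c)" if "(a, b, c) \<in> U" for a b c
  proof -
    have "4 * (a\<^sup>2 + c\<^sup>2 + b * (b + 1)) = 4 * int N"
      using that by (simp add: U_def m_def power2_eq_square algebra_simps)
    then have "a\<^sup>2 + c\<^sup>2 + b * (b + 1) = int N"
      by (subst (asm) mult_cancel_left) simp
    then have "even (a\<^sup>2 + c\<^sup>2 + b * (b + 1))" using assms(1) by (simp only: even_of_nat)
    then show ?thesis by simp
  qed
  have eq: "nat (a\<^sup>2) + (tri k + tri l) = N \<longleftrightarrow> 8 * a\<^sup>2 + (2 * k + 1)\<^sup>2 + (2 * l + 1)\<^sup>2 = 2 * m" for a k l
  proof -
    have "int (nat (a\<^sup>2) + (tri k + tri l)) = a\<^sup>2 + int (tri k) + int (tri l)" by simp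
    then have "nat (a\<^sup>2) + (tri k + tri l) = N \<longleftrightarrow> a\<^sup>2 + int (tri k) + int (tri l) = int N"
      by linarith
    moreover have "(2 * k + 1)\<^sup>2 = 8 * int (tri k) + 1" "(2 * l + 1)\<^sup>2 = 8 * int (tri l) + 1"
      using int_tri[of k] int_tri[of l] by simp_all
    ultimately show ?thesis unfolding m_def by auto
  qed
  have "jacobi_cube\<^sup>2 * gauss_square = gauss_square * (jacobi_cube * jacobi_cube)"
    by (simp add: power2_eq_square mult.commute)
  also have "\<dots> = theta (\<lambda>(a, k, l). parity_sign a * (parity_sign k * (2 * k + 1) * (parity_sign l * (2 * l + 1))))
      (\<lambda>(a, k, l). nat (a\<^sup>2) + (tri k + tri l))"
    unfolding gauss_square_def jacobi_cube_def
    by (subst theta_mult, (rule fin)+, subst theta_mult, rule fin, rule finite_fibre_prod, (rule fin)+)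
      (simp add: case_prod_unfold)
  finally have eq': "jacobi_cube\<^sup>2 * gauss_square = \<dots>" .
  have coeff: "fps_nth (jacobi_cube\<^sup>2 * gauss_square) N = (\<Sum>(a, k, l)\<in>A. g a k l)"
    unfolding eq' by (simp add: theta_def case_prod_unfold eq A_def g_def parity_sign_add mult_ac)

  have "finite A"
  proof -
    have "A = {t. (\<lambda>(a, s). nat (a\<^sup>2) + (\<lambda>(k, l). tri k + tri l) s) t = N}"
      by (auto simp: A_def eq[symmetric])
    then show ?thesis
      by (simp only:) (intro finite_fibre_prod fin)
  qed
  \<comment> \<open>The reflection \<open>l \<mapsto> - 1 - l\<close> preserves the weight and exchanges even and odd \<open>k + l\<close>.\<close>
  have "(\<Sum>(a, k, l)\<in>A. g a k l)
      = (\<Sum>(a, k, l)\<in>{(a, k, l) \<in> A. even (k + l)}. g a k l)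
        + (\<Sum>(a, k, l)\<in>{(a, k, l) \<in> A. odd (k + l)}. g a k l)"
    by (subst sum.union_disjoint[symmetric]) (auto intro: finite_subset[OF _ \<open>finite A\<close>] intro!: sum.cong)
  also have "(\<Sum>(a, k, l)\<in>{(a, k, l) \<in> A. odd (k + l)}. g a k l)
      = (\<Sum>(a, k, l)\<in>{(a, k, l) \<in> A. even (k + l)}. g a k l)"
  proof (rule sum.reindex_bij_witness[of _ "\<lambda>(a, k, l). (a, k, - 1 - l)" "\<lambda>(a, k, l). (a, k, - 1 - l)"])
    have A: "(a, k, - 1 - l) \<in> A" if "(a, k, l) \<in> A" for a k l
    proof -
      have "(2 * (- 1 - l) + 1)\<^sup>2 = (2 * l + 1)\<^sup>2"
        by (simp add: power2_eq_square algebra_simps)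
      then show ?thesis using that unfolding A_def by simp
    qed
    fix t
    show "(case t of (a, k, l) \<Rightarrow> (a, k, - 1 - l)) \<in> {(a, k, l) \<in> A. even (k + l)}"
      if "t \<in> {(a, k, l) \<in> A. odd (k + l)}"
      using that A by (cases t) auto
    show "(case t of (a, k, l) \<Rightarrow> (a, k, - 1 - l)) \<in> {(a, k, l) \<in> A. odd (k + l)}"
      if "t \<in> {(a, k, l) \<in> A. even (k + l)}"
      using that A by (cases t) auto
    have "g a k (- 1 - l) = g a k l" for a k l
      unfolding g_def by (auto simp: parity_sign_def algebra_simps)
    then show "(case case t of (a, k, l) \<Rightarrow> (a, k, - 1 - l) of (a, k, l) \<Rightarrow> g a k l)
        = (case t of (a, k, l) \<Rightarrow> g a k l)"
      by (cases t) simp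
  qed auto
  \<comment> \<open>First rotation: \<open>k = b + c\<close> and \<open>l = b - c\<close>.\<close>
  also have "(\<Sum>(a, k, l)\<in>{(a, k, l) \<in> A. even (k + l)}. g a k l) = S"
    unfolding S_def
  proof (rule sum.reindex_bij_witness[of _ "\<lambda>(a, b, c). (a, b + c, b - c)" "\<lambda>(a, k, l). (a, (k + l) div 2, (k - l) div 2)"])
    fix t assume t: "t \<in> {(a, k, l) \<in> A. even (k + l)}"
    obtain a k l where akl: "t = (a, k, l)" by (cases t)
    have "even (k + l)" using t unfolding akl by simp
    then obtain b where b: "k + l = 2 * b" by (rule evenE)
    define c where "c = k - b"
    have kl: "k = b + c" "l = b - c" using b by (auto simp: c_def)
    have A: "(a, k, l) \<in> A" using t unfolding akl by auto
    have half: "(k + l) div 2 = b" "(k - l) div 2 = c" by (simp_all add: kl)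
    show "(case case t of (a, k, l) \<Rightarrow> (a, (k + l) div 2, (k - l) div 2) of (a, b, c) \<Rightarrow> (a, b + c, b - c)) = t"
      unfolding akl by (simp add: half kl)
    show "(case t of (a, k, l) \<Rightarrow> (a, (k + l) div 2, (k - l) div 2)) \<in> U"
      using A unfolding akl by (simp add: half) (simp add: kl A_def U_def power2_eq_square algebra_simps)
    show "(case case t of (a, k, l) \<Rightarrow> (a, (k + l) div 2, (k - l) div 2) of
         (a, b, c) \<Rightarrow> parity_sign a * ((2 * b + 1)\<^sup>2 - 4 * c\<^sup>2)) = (case t of (a, k, l) \<Rightarrow> g a k l)"
      unfolding akl by (simp add: half)
        (simp add: kl g_def parity_sign_def power2_eq_square algebra_simps)
  next
    fix t assume "t \<in> U"
    then show "(case t of (a, b, c) \<Rightarrow> (a, b + c, b - c)) \<in> {(a, k, l) \<in> A. even (k + l)}"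
      by (auto simp: A_def U_def power2_eq_square algebra_simps)
  qed (auto)
  finally have "fps_nth (jacobi_cube\<^sup>2 * gauss_square) N = 2 * S"
    using coeff by simp
  \<comment> \<open>Averaging over the exchange of \<open>a\<close> and \<open>c\<close> makes the weight depend on \<open>a\<^sup>2 + c\<^sup>2\<close> only.\<close>
  also have "2 * S = (\<Sum>(a, b, c)\<in>U. parity_sign a * (2 * (2 * b + 1)\<^sup>2 - 4 * a\<^sup>2 - 4 * c\<^sup>2))"
  proof -
    have "S = (\<Sum>(a, b, c)\<in>U. parity_sign a * ((2 * b + 1)\<^sup>2 - 4 * a\<^sup>2))"
      unfolding S_def
    proof (rule sum.reindex_bij_witness[of _ "\<lambda>(a, b, c). (c, b, a)" "\<lambda>(a, b, c). (c, b, a)"])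
      fix t assume t: "t \<in> U"
      obtain a b c where abc: "t = (a, b, c)" by (cases t)
      have "even (a + c)" using par t unfolding abc by blast
      then have "parity_sign c = parity_sign a" by (auto simp: parity_sign_def)
      then show "(case case t of (a, b, c) \<Rightarrow> (c, b, a) of (a, b, c) \<Rightarrow> parity_sign a * ((2 * b + 1)\<^sup>2 - 4 * a\<^sup>2))
          = (case t of (a, b, c) \<Rightarrow> parity_sign a * ((2 * b + 1)\<^sup>2 - 4 * c\<^sup>2))"
        unfolding abc by simp
    qed (auto simp: U_def)
    then have "2 * S = (\<Sum>(a, b, c)\<in>U. parity_sign a * ((2 * b + 1)\<^sup>2 - 4 * a\<^sup>2)) + S" by simp
    then show ?thesis
      unfolding S_def sum.distrib[symmetric] by (simp add: case_prod_unfold algebra_simps)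
  qed
  \<comment> \<open>Second rotation: \<open>a = u + w\<close> and \<open>c = u - w\<close>, with \<open>4 * (a\<^sup>2 + c\<^sup>2) = m - y\<^sup>2\<close>.\<close>
  also have "\<dots> = (\<Sum>(u, w, y)\<in>ternary m. parity_sign (u + w) * (3 * y\<^sup>2 - m))"
  proof (rule sum.reindex_bij_witness[of _ "\<lambda>(u, w, y). (u + w, (y - 1) div 2, u - w)"
        "\<lambda>(a, b, c). ((a + c) div 2, (a - c) div 2, 2 * b + 1)"])
    fix t assume t: "t \<in> U"
    obtain a b c where abc: "t = (a, b, c)" by (cases t)
    have "even (a + c)" using par t unfolding abc by blast
    then obtain u where u: "a + c = 2 * u" by (rule evenE)
    define w where "w = a - u"
    have ac: "a = u + w" "c = u - w" using u by (auto simp: w_def)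
    have half: "(a + c) div 2 = u" "(a - c) div 2 = w" by (simp_all add: ac)
    have m: "m = 8 * u\<^sup>2 + 8 * w\<^sup>2 + (2 * b + 1)\<^sup>2"
      using t unfolding abc by (simp add: U_def ac power2_eq_square algebra_simps)
    show "(case case t of (a, b, c) \<Rightarrow> ((a + c) div 2, (a - c) div 2, 2 * b + 1) of
         (u, w, y) \<Rightarrow> (u + w, (y - 1) div 2, u - w)) = t"
      unfolding abc by (simp add: half) (simp add: ac)
    show "(case t of (a, b, c) \<Rightarrow> ((a + c) div 2, (a - c) div 2, 2 * b + 1)) \<in> ternary m"
      unfolding abc by (simp add: half ternary_def m)
    show "(case case t of (a, b, c) \<Rightarrow> ((a + c) div 2, (a - c) div 2, 2 * b + 1) of
         (u, w, y) \<Rightarrow> parity_sign (u + w) * (3 * y\<^sup>2 - m))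
        = (case t of (a, b, c) \<Rightarrow> parity_sign a * (2 * (2 * b + 1)\<^sup>2 - 4 * a\<^sup>2 - 4 * c\<^sup>2))"
      unfolding abc by (simp add: half) (simp add: ac m power2_eq_square algebra_simps)
  next
    fix t assume "t \<in> ternary m"
    then show "(case t of (u, w, y) \<Rightarrow> (u + w, (y - 1) div 2, u - w)) \<in> U"
      by (auto simp: ternary_def U_def power2_eq_square algebra_simps elim!: oddE)
  qed (auto simp: ternary_def elim!: oddE)
  finally have coeff': "fps_nth (jacobi_cube\<^sup>2 * gauss_square) N = \<dots>" .

  obtain h where "4 * Abs_fps d - jacobi_cube\<^sup>2 * gauss_square = 9 * h"
    using d_generating_function_mod_9 by (rule dvdE)
  then have "fps_nth (4 * Abs_fps d - jacobi_cube\<^sup>2 * gauss_square) N = fps_nth (9 * h) N" by simp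
  then have "4 * d N - fps_nth (jacobi_cube\<^sup>2 * gauss_square) N = 9 * fps_nth h N"
    by (simp add: numeral_fps_const)
  then show ?thesis unfolding coeff' by simp
qed

lemma nine_dvd_d:
  assumes "even N" "3 dvd 4 * int N + 1" "\<nexists>s. 4 * int N + 1 = s\<^sup>2"
  shows "9 dvd d N"
proof -
  define m where "m = 4 * int N + 1"
  have "(\<Sum>(u, w, y)\<in>ternary m. parity_sign (u + w) * (3 * y\<^sup>2 - m))
      = 3 * (\<Sum>(u, w, y)\<in>ternary m. parity_sign (u + w) * y\<^sup>2)
        - m * (\<Sum>(u, w, y)\<in>ternary m. parity_sign (u + w))"
    by (simp add: case_prod_unfold sum_distrib_left sum_subtractf algebra_simps)
  also have "\<dots> = 3 * (\<Sum>(u, w, y)\<in>ternary m. parity_sign (u + w) * y\<^sup>2)"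
    using sum_ternary_eq_0[of m] assms(3) by (simp add: m_def)
  finally have 1: "9 dvd 4 * d N - 3 * (\<Sum>(u, w, y)\<in>ternary m. parity_sign (u + w) * y\<^sup>2)"
    using d_mod_9_ternary[OF assms(1)] by (simp add: m_def)
  have "3 dvd (\<Sum>(u, w, y)\<in>ternary m. parity_sign (u + w) * y\<^sup>2)"
    using weighted_sum_ternary[of m] assms by (simp add: m_def)
  then have 2: "9 dvd 3 * (\<Sum>(u, w, y)\<in>ternary m. parity_sign (u + w) * y\<^sup>2)"
    using mult_dvd_mono[of "3 :: int" 3 3] by simp
  from dvd_add[OF 1 2] have "9 dvd 4 * d N" by simp
  then show ?thesis by presburger
qed

theorem theorem5p3:
  fixes n \<alpha> p j :: nat
  assumes "\<alpha> \<ge> 1" and "prime p" and "p \<ge> 5" and "j \<in> {1..p - 1}"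
  shows "[d (6 * p ^ (2 * \<alpha>) * n + ((24 * j + 9 * p) * p ^ (2 * \<alpha> - 1) - 1) div 4) = 0] (mod 9)"
proof -
  define P where "P = p ^ (2 * \<alpha> - 1)"
  define N where "N = 6 * p ^ (2 * \<alpha>) * n + ((24 * j + 9 * p) * P - 1) div 4"
  define c where "c = 8 * p * n + 8 * j + 3 * p"
  have "odd p" using prime_odd_nat[OF assms(2)] assms(3) by simp
  have P: "p ^ (2 * \<alpha>) = p * P"
    unfolding P_def using assms(1) by (subst power_Suc[symmetric]) simp
  have "P \<ge> 1" using assms(3) by (simp add: P_def)
  define Q where "Q = (24 * j + 9 * p) * P"
  define K where "K = (Q - 1) div 4"
  have "4 * K = Q - 1"
    using argument_exact[OF \<open>odd p\<close> assms(1), of j] unfolding K_def Q_def P_def by simp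
  moreover have "Q \<ge> 1"
    using \<open>P \<ge> 1\<close> assms(3) by (simp add: Q_def)
  moreover have "N = 6 * (p * P * n) + K"
    unfolding N_def K_def Q_def P by simp
  ultimately have "4 * N + 1 = 24 * (p * P * n) + (24 * j + 9 * p) * P"
    unfolding Q_def[symmetric] by simp
  then have N: "4 * N + 1 = 3 * P * c"
    by (simp add: c_def algebra_simps)
  have "even N"
  proof -
    \<comment> \<open>Odd squares are 1 modulo 8, so \<open>4 * N + 1\<close> is 1 modulo 8.\<close>
    have "odd (p ^ \<alpha>)" using \<open>odd p\<close> by simp
    then obtain k where k: "p ^ \<alpha> = 2 * k + 1" by (rule oddE)
    have "even (k * (k + 1))" by simp
    then obtain t where "k * (k + 1) = 2 * t" by (rule evenE)
    then have "(p ^ \<alpha>)\<^sup>2 = 8 * t + 1"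
      unfolding k by (simp add: power2_eq_square algebra_simps)
    then have "(p ^ \<alpha>)\<^sup>2 mod 8 = 1" by simp
    then have "(p * P) mod 8 = 1"
      unfolding P[symmetric] by (simp only: power_mult[symmetric] mult.commute)
    moreover have "4 * N + 1 = 8 * (3 * P * (p * n + j) + p * P) + p * P"
      unfolding N c_def by (simp add: algebra_simps)
    ultimately have "(4 * N + 1) mod 8 = 1" by (simp only: mod_mult_self4)
    then show ?thesis by presburger
  qed
  moreover have int_N: "4 * int N + 1 = int (3 * P * c)"
    using N by linarith
  then have "3 dvd 4 * int N + 1" by simp
  moreover have "\<nexists>s. 4 * int N + 1 = s\<^sup>2"
  proof
    assume "\<exists>s. 4 * int N + 1 = s\<^sup>2"
    then obtain s where "int (3 * P * c) = s\<^sup>2" using int_N by auto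
    then have "3 * P * c = (nat \<bar>s\<bar>)\<^sup>2"
      by (metis nat_int nat_power_eq abs_ge_zero power2_abs)
    then have "multiplicity p (3 * P * c) = 2 * multiplicity p (nat \<bar>s\<bar>)"
      using assms(2) N by (metis add_is_0 one_neq_zero power_eq_0_iff prime_elem_multiplicity_power_distrib prime_imp_prime_elem pos2)
    \<comment> \<open>The multiplicity of \<open>p\<close> in a square is even, but \<open>p\<close> divides neither 3 nor \<open>c\<close>.\<close>
    moreover have "multiplicity p (3 * P * c) = 2 * \<alpha> - 1"
    proof -
      have "\<not> p dvd 3"
        using assms(3) by (auto dest: dvd_imp_le)
      moreover have "\<not> p dvd c"
      proof
        assume "p dvd c"
        moreover have "c = p * (8 * n + 3) + 8 * j" by (simp add: c_def algebra_simps)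
        ultimately have "p dvd 8 * j" by (simp add: dvd_add_right_iff)
        moreover have "\<not> p dvd 8"
          using assms(2,3) prime_dvd_power[of p 2 3] dvd_imp_le[of p 2] by auto
        ultimately have "p dvd j" using assms(2) by (simp add: prime_dvd_mult_iff)
        then show False using assms(4) dvd_imp_le[of p j] by auto
      qed
      ultimately have "\<not> p dvd 3 * c" using assms(2) by (simp add: prime_dvd_mult_iff)
      moreover have "3 * P * c = p ^ (2 * \<alpha> - 1) * (3 * c)" by (simp add: P_def)
      ultimately show ?thesis
        by (intro multiplicity_eqI) (use assms(2) in auto)
    qed
    ultimately have "2 * \<alpha> - 1 = 2 * multiplicity p (nat \<bar>s\<bar>)" by simp
    then show False using assms(1) by presburger
  qed
  ultimately have "9 dvd d N" by (rule nine_dvd_d)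
  then show ?thesis by (simp add: cong_0_iff N_def P_def)
qed

end
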